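(* Let $\Gamma=(X_i,A_i,P_i,B_i)_{i\in I}$ be an abstract economy, where $I$ is a (possibly uncountable) non-empty set of agents, and put $X=\prod_{i\in I}X_i$. Suppose that for each $i\in I$: (1) $X_i$ is a non-empty compact convex set in a locally convex space $E_i$; (2) $\operatorname{cl}B_i$ is upper semicontinuous with non-empty convex values; (3) the set $W_i:=\{x\in X:(A_i\cap P_i)(x)\neq\emptyset\}$ is open and there exists an $(n_i-1)$-dimensional simplex $K_i$ in $X$ (for some positive integer $n_i$) such that $W_i\subset\operatorname{int}_X(K_i)$; (4) $\operatorname{cl}B_i$ has the e-WNQS-property on $K_i$. Then there exists an equilibrium point $\overline{x}\in X$ for $\Gamma$, i.e. a point $\overline{x}\in X$ such that for each $i\in I$, $\overline{x}_i\in\overline{B}_i(\overline{x})$ and $A_i(\overline{x})\cap P_i(\overline{x})=\emptyset$.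
   Context: An abstract economy $\Gamma=(X_i,A_i,P_i,B_i)_{i\in I}$ consists of a set $I$ of agents and, for each $i\in I$, a set of actions $X_i$, constraint correspondences $A_i,B_i:X\to 2^{X_i}$ and a preference correspondence $P_i:X\to 2^{X_i}$, where $X=\prod_{i\in I}X_i$ (product topology) and $2^{X_i}$ is the family of all subsets of $X_i$. For $x\in X$, $x_i$ is its $i$-th coordinate. $(\operatorname{cl}B_i)(x)=\operatorname{cl}B_i(x)$ is the closure of $B_i(x)$ (in $X_i$); $(A_i\cap P_i)(x)=A_i(x)\cap P_i(x)$; $\operatorname{int}_X$ denotes interior in $X$; $\overline{B}_i(x)=\{y\in X_i:(x,y)\in\operatorname{cl}_{X\times X_i}\operatorname{Gr}B_i\}$, where $\operatorname{Gr}B_i=\{(x,y)\in X\times X_i: y\in B_i(x)\}$. A correspondence $T:X\to 2^Y$ is upper semicontinuous if for each $x\in X$ and each open $V\subset Y$ with $T(x)\subset V$ there is an open neighborhood $U$ of $x$ with $T(y)\subset V$ for all $y\in U$. An $(n-1)$-dimensional simplex is the convex hull of $n$ affinely independent points. Let $\Delta_{n-1}=\{(\lambda_1,\dots,\lambda_n)\in\mathbb{R}^n:\sum_{i=1}^n\lambda_i=1,\ \lambda_i\ge 0 \text{ for all } i\}$. Weakly naturally quasi-concave (WNQ): let $Z$ be a non-empty convex subset of a topological vector space and $Y$ a non-empty subset of a topological vector space. A correspondence $T:Z\to 2^{Y}$ is weakly naturally quasi-concave if for each $n$ and each finite set $\{x_1,\dots,x_n\}\subset Z$ there exist $y_i\in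 T(x_i)$ ($i=1,\dots,n$) and continuous functions $g_i:[0,1]\to[0,1]$ with $g_i(0)=0$ and $g_i(1)=1$ ($i=1,\dots,n$) such that $(g_1(\lambda_1),\dots,g_n(\lambda_n))\in\Delta_{n-1}$ whenever $(\lambda_1,\dots,\lambda_n)\in\Delta_{n-1}$, and such that for every $(\lambda_1,\dots,\lambda_n)\in\Delta_{n-1}$ one has $\sum_{i=1}^n g_i(\lambda_i)y_i\in T\left(\sum_{i=1}^n\lambda_i x_i\right)$. e-WNQS-property: for $K_i\subset X$, a correspondence $C_i:X\to 2^{X_i}$ has the e-WNQS-property on $K_i$ if for each convex neighborhood $V$ of $0$ in $E_i$ there is a weakly naturally quasi-concave correspondence $T_i^{V}:K_i\to 2^{X_i}$ such that $x_i\notin T_i^{V}(x)$ and $T_i^{V}(x)\subset C_i(x)+V$ for all $x\in K_i$. *)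

theory Defs
  imports "HOL-Analysis.Analysis" "HOL-Library.Function_Algebras"
begin

text \<open>Functions into a real vector space form a real vector space pointwise; this is the linear
  structure of the product of the spaces \<open>E i\<close>, in which convex combinations of action
  profiles and simplices are formed.\<close>

instantiation "fun" :: (type, real_vector) real_vector
begin

definition scaleR_fun :: "real \<Rightarrow> ('a \<Rightarrow> 'b) \<Rightarrow> 'a \<Rightarrow> 'b" where
  "scaleR_fun r f = (\<lambda>x. r *\<^sub>R f x)"

instance
  by standard (simp_all add: scaleR_fun_def plus_fun_def scaleR_add_right scaleR_add_left)

end


section \<open>Locally convex spaces\<close>

text \<open>The spaces \<open>E i\<close> may differ from agent to agent, so their topologies cannot come
  from a type class. A locally convex space is a linear subspace of a real vector space type
  together with its own topology; any family of such spaces embeds linearly into one type (for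
  instance their direct sum), so nothing is lost. No separation axiom is imposed.\<close>

definition topological_vector_space :: "'e::real_vector topology \<Rightarrow> bool" where
  "topological_vector_space E \<longleftrightarrow>
     subspace (topspace E) \<and>
     continuous_map (prod_topology E E) E (\<lambda>(x, y). x + y) \<and>
     continuous_map (prod_topology euclideanreal E) E (\<lambda>(c, x). c *\<^sub>R x)"

definition neighborhood_of_zero :: "'e::real_vector topology \<Rightarrow> 'e set \<Rightarrow> bool" where
  "neighborhood_of_zero E V \<longleftrightarrow>
     V \<subseteq> topspace E \<and> (\<exists>U. openin E U \<and> 0 \<in> U \<and> U \<subseteq> V)"

definition locally_convex_space :: "'e::real_vector topology \<Rightarrow> bool" where
  "locally_convex_space E \<longleftrightarrow>
     topological_vector_space E \<and>
     (\<forall>V. neighborhood_of_zero E V \<longrightarrow>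
        (\<exists>U. neighborhood_of_zero E U \<and> convex U \<and> U \<subseteq> V))"


section \<open>Simplices\<close>

text \<open>The library constant \<open>simplex\<close> is restricted to Euclidean spaces.\<close>

definition simplex_on :: "nat \<Rightarrow> 'z::real_vector set \<Rightarrow> bool" where
  "simplex_on n K \<longleftrightarrow>
     (\<exists>C. finite C \<and> card C = n \<and> \<not> affine_dependent C \<and> K = convex hull C)"

text \<open>Vectors of length \<open>n\<close> are functions on \<open>{1..n}\<close>; values outside are irrelevant.\<close>

definition std_simplex :: "nat \<Rightarrow> (nat \<Rightarrow> real) set" where
  "std_simplex n = {l. (\<Sum>k=1..n. l k) = 1 \<and> (\<forall>k\<in>{1..n}. 0 \<le> l k)}"


section \<open>Correspondences\<close>

definition correspondence :: "'a set \<Rightarrow> 'b set \<Rightarrow> ('a \<Rightarrow> 'b set) \<Rightarrow> bool" where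
  "correspondence S Y T \<longleftrightarrow> (\<forall>x\<in>S. T x \<subseteq> Y)"

definition upper_semicontinuous ::
    "'a topology \<Rightarrow> 'b topology \<Rightarrow> ('a \<Rightarrow> 'b set) \<Rightarrow> bool" where
  "upper_semicontinuous TX TY T \<longleftrightarrow>
     (\<forall>x\<in>topspace TX. \<forall>V. openin TY V \<and> T x \<subseteq> V \<longrightarrow>
        (\<exists>U. openin TX U \<and> x \<in> U \<and> (\<forall>y\<in>U. T y \<subseteq> V)))"

definition weakly_naturally_quasi_concave ::
    "'z::real_vector set \<Rightarrow> ('z \<Rightarrow> 'y::real_vector set) \<Rightarrow> bool" where
  "weakly_naturally_quasi_concave Z T \<longleftrightarrow>
     (\<forall>n. \<forall>x::nat \<Rightarrow> 'z. inj_on x {1..n} \<and> x ` {1..n} \<subseteq> Z \<longrightarrow>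
        (\<exists>(y::nat \<Rightarrow> 'y) (g::nat \<Rightarrow> real \<Rightarrow> real).
           (\<forall>k\<in>{1..n}. y k \<in> T (x k)) \<and>
           (\<forall>k\<in>{1..n}. continuous_on {0..1} (g k) \<and> g k ` {0..1} \<subseteq> {0..1} \<and>
              g k 0 = 0 \<and> g k 1 = 1) \<and>
           (\<forall>l\<in>std_simplex n. (\<lambda>k. g k (l k)) \<in> std_simplex n) \<and>
           (\<forall>l\<in>std_simplex n.
              (\<Sum>k=1..n. g k (l k) *\<^sub>R y k) \<in> T (\<Sum>k=1..n. l k *\<^sub>R x k))))"


section \<open>Abstract economies\<close>

text \<open>The agents are the elements of the (non-empty, otherwise arbitrary) type \<open>'i\<close>. Agent
  \<open>i\<close> has the ambient space \<open>E i\<close> and the action set \<open>X i\<close>.\<close>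

abbreviation action_top :: "('i \<Rightarrow> 'e topology) \<Rightarrow> ('i \<Rightarrow> 'e set) \<Rightarrow> 'i \<Rightarrow> 'e topology" where
  "action_top E X i \<equiv> subtopology (E i) (X i)"

abbreviation profiles :: "('i \<Rightarrow> 'e set) \<Rightarrow> ('i \<Rightarrow> 'e) set" where
  "profiles X \<equiv> \<Pi>\<^sub>E i\<in>UNIV. X i"

abbreviation profile_top :: "('i \<Rightarrow> 'e topology) \<Rightarrow> ('i \<Rightarrow> 'e set) \<Rightarrow> ('i \<Rightarrow> 'e) topology" where
  "profile_top E X \<equiv> product_topology (action_top E X) UNIV"

definition abstract_economy ::
    "('i \<Rightarrow> 'e set) \<Rightarrow> ('i \<Rightarrow> ('i \<Rightarrow> 'e) \<Rightarrow> 'e set) \<Rightarrow> ('i \<Rightarrow> ('i \<Rightarrow> 'e) \<Rightarrow> 'e set) \<Rightarrow>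
     ('i \<Rightarrow> ('i \<Rightarrow> 'e) \<Rightarrow> 'e set) \<Rightarrow> bool" where
  "abstract_economy X A P B \<longleftrightarrow>
     (\<forall>i. correspondence (profiles X) (X i) (A i) \<and>
          correspondence (profiles X) (X i) (P i) \<and>
          correspondence (profiles X) (X i) (B i))"

definition cl_corr :: "'b topology \<Rightarrow> ('a \<Rightarrow> 'b set) \<Rightarrow> 'a \<Rightarrow> 'b set" where
  "cl_corr TY T x = TY closure_of (T x)"

definition graph_closure_corr ::
    "'a topology \<Rightarrow> 'b topology \<Rightarrow> ('a \<Rightarrow> 'b set) \<Rightarrow> 'a \<Rightarrow> 'b set" where
  "graph_closure_corr TX TY T x =
     {y \<in> topspace TY. (x, y) \<in> prod_topology TX TY closure_of
        {(u, v). u \<in> topspace TX \<and> v \<in> topspace TY \<and> v \<in> T u}}"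

definition e_WNQS ::
    "('i \<Rightarrow> 'e::real_vector topology) \<Rightarrow> ('i \<Rightarrow> 'e set) \<Rightarrow> 'i \<Rightarrow> ('i \<Rightarrow> 'e) set \<Rightarrow>
     (('i \<Rightarrow> 'e) \<Rightarrow> 'e set) \<Rightarrow> bool" where
  "e_WNQS E X i K C \<longleftrightarrow>
     (\<forall>V. neighborhood_of_zero (E i) V \<and> convex V \<longrightarrow>
        (\<exists>T. correspondence K (X i) T \<and> weakly_naturally_quasi_concave K T \<and>
           (\<forall>x\<in>K. x i \<notin> T x \<and> T x \<subseteq> {c + v | c v. c \<in> C x \<and> v \<in> V})))"

definition equilibrium_point ::
    "('i \<Rightarrow> 'e topology) \<Rightarrow> ('i \<Rightarrow> 'e set) \<Rightarrow> ('i \<Rightarrow> ('i \<Rightarrow> 'e) \<Rightarrow> 'e set) \<Rightarrow>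
     ('i \<Rightarrow> ('i \<Rightarrow> 'e) \<Rightarrow> 'e set) \<Rightarrow> ('i \<Rightarrow> ('i \<Rightarrow> 'e) \<Rightarrow> 'e set) \<Rightarrow> ('i \<Rightarrow> 'e) \<Rightarrow> bool" where
  "equilibrium_point E X A P B x \<longleftrightarrow>
     x \<in> profiles X \<and>
     (\<forall>i. x i \<in> graph_closure_corr (profile_top E X) (action_top E X i) (B i) x \<and>
          A i x \<inter> P i x = {})"

end

theory Submission
  imports Defs
begin

text \<open>Suppose that no profile is an equilibrium. Then every profile \<open>a\<close> fails for some agent \<open>i\<close>, either
  because \<open>a\<close> is in the open set \<open>W i\<close> where constraint and preference meet, or because \<open>(a, a i)\<close> is
  off the closure of the graph of \<open>B i\<close>. Both reasons persist on a neighbourhood of \<open>a\<close>, the second one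
  with a margin (\<open>separation_off_graph_closure\<close>). The profile space is compact, so finitely
  many such neighbourhoods cover it, and only finitely many agents and margins matter. It is therefore
  enough to find an approximate equilibrium for finitely many agents, up to prescribed convex
  neighbourhoods of 0 (\<open>approximate_equilibrium\<close>).

  For a single agent two approximations are blended (\<open>blended_selection\<close>). On the simplex \<open>K i\<close>, weak
  natural quasi-concavity of the correspondence \<open>T\<close> from the e-WNQS property gives a selection of \<open>T\<close>
  that is continuous in the barycentric coordinates (\<open>WNQ_selection\<close>). On the whole profile space, a partition
  of unity averages finitely many values of the closure of \<open>B i\<close>; by upper semicontinuity and convexity
  the average is close to a value at a nearby point, provided that the partition refines
  the cover in the strong sense of \<open>star_refining_partition_of_unity\<close>. A Urysohn function supported in
  \<open>W i\<close> switches from the second map to the first. At a fixed point \<open>x\<close> of all these maps, \<open>x\<close> cannot lie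
  where the first map is fully switched on, since \<open>x i \<in> T x\<close> is excluded; and \<open>x i\<close> is always close to a
  nearby value of the closure of \<open>B i\<close>, since both maps are.

  The fixed point exists because all maps take values in polytopes with finitely many vertices, and
  only finitely many coordinates move: Brouwer's theorem for a product of simplices is applied to the
  weights of the vertices (\<open>brouwer_simplex_product\<close>, \<open>polytopes_fixed_point\<close>). The spaces need not be
  Hausdorff, so barycentric coordinates on \<open>K i\<close> need not be continuous on \<open>K i\<close>. They do,
  however, extend to affine functionals on the whole space, and such a functional is
  continuous in the weights of a polytope. All continuity that Brouwer's theorem asks for is continuity in the weights.\<close>


section \<open>Brouwer's theorem for products of simplices\<close>

lemma tendsto_fun_iff:
  fixes f :: "'b \<Rightarrow> 'i \<Rightarrow> 'a::topological_space"
  shows "(f \<longlongrightarrow> l) F \<longleftrightarrow> (\<forall>i. ((\<lambda>x. f x i) \<longlongrightarrow> l i) F)"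
  using limitin_componentwise[of "\<lambda>i. euclidean" UNIV f l F]
  by (simp add: euclidean_product_topology)

text \<open>Kuhn's combinatorial lemma does the work. On the grid of mesh \<open>1/p\<close>, a vertex is labelled 0 in
  coordinate \<open>i\<close> if \<open>f\<close> does not decrease that coordinate there. Kuhn's lemma gives a small cube that
  has, for every \<open>i\<close>, vertices of both labels; the small cubes accumulate at a point, where continuity
  yields both inequalities between \<open>f x i\<close> and \<open>x i\<close>. The dimension is a number and not a type, because
  the dimension needed later depends on finite covers that are chosen inside a proof.\<close>

lemma brouwer_nat_cube:
  fixes f :: "(nat \<Rightarrow> real) \<Rightarrow> nat \<Rightarrow> real" and n :: nat
  defines "Q \<equiv> Pi\<^sub>E UNIV (\<lambda>i. if i < n then {0..1} else {0::real})"
  assumes cont: "\<And>i. i < n \<Longrightarrow> continuous_on Q (\<lambda>x. f x i)"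
    and into: "\<And>x i. x \<in> Q \<Longrightarrow> i < n \<Longrightarrow> f x i \<in> {0..1}"
  obtains x where "x \<in> Q" "\<And>i. i < n \<Longrightarrow> f x i = x i"
proof -
  have Q: "x \<in> Q \<longleftrightarrow> (\<forall>i<n. 0 \<le> x i \<and> x i \<le> 1) \<and> (\<forall>i\<ge>n. x i = 0)" for x
  proof -
    have "x \<in> Q \<longleftrightarrow> (\<forall>i. x i \<in> (if i < n then {0..1} else {0}))"
      by (simp add: Q_def PiE_iff)
    also have "\<dots> \<longleftrightarrow> (\<forall>i. (i < n \<longrightarrow> 0 \<le> x i \<and> x i \<le> 1) \<and> (i \<ge> n \<longrightarrow> x i = 0))"
      by (rule all_cong1) auto
    finally show ?thesis by blast
  qed
  have "compactin (product_topology (\<lambda>i. euclidean) UNIV) Q"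
    unfolding Q_def compactin_PiE by auto
  then have "compact Q"
    by (simp add: euclidean_product_topology)
  then have seq: "seq_compact Q"
    by (simp add: compact_eq_seq_compact_metric)
  \<comment> \<open>The grid point with integer coordinates \<open>q\<close>, padded by zeros so that it lies in \<open>Q\<close>.\<close>
  define pt :: "nat \<Rightarrow> (nat \<Rightarrow> nat) \<Rightarrow> nat \<Rightarrow> real"
    where "pt p q = (\<lambda>i. if i < n then real (q i) / real p else 0)" for p q
  have ptQ: "pt p q \<in> Q" if "0 < p" "\<forall>i<n. q i \<le> p" for p q
    using that by (auto simp: Q pt_def)
  define near where "near q r \<longleftrightarrow> (\<forall>j<n. q j \<le> r j \<and> r j \<le> q j + 1)" for q r :: "nat \<Rightarrow> nat"
  have "\<exists>q R S. (\<forall>i<n. q i < Suc p) \<and> (\<forall>i<n. near q (R i) \<and> near q (S i) \<and>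
          pt (Suc p) (R i) i \<le> f (pt (Suc p) (R i)) i \<and> f (pt (Suc p) (S i)) i \<le> pt (Suc p) (S i) i)" for p
  proof -
    define P where "P = Suc p"
    define label :: "(nat \<Rightarrow> nat) \<Rightarrow> nat \<Rightarrow> nat"
      \<comment> \<open>The test \<open>q i \<noteq> P\<close> forces label 1 on the far face, where \<open>f x i \<le> x i\<close> holds anyway.\<close>
      where "label q i = (if q i \<noteq> P \<and> pt P q i \<le> f (pt P q) i then 0 else 1)" for q i
    have P: "0 < P" by (simp add: P_def)
    have zero: "label q i = 0" if "\<forall>i<n. q i \<le> P" "i < n" "q i = 0" for q i
      using into[OF ptQ[OF P that(1)] that(2)] that P by (auto simp: label_def pt_def)
    obtain q where q: "\<forall>i<n. q i < P" and
      "\<forall>i<n. \<exists>r s. (\<forall>j<n. q j \<le> r j \<and> r j \<le> q j + 1) \<and> (\<forall>j<n. q j \<le> s j \<and> s j \<le> q j + 1)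
          \<and> label r i \<noteq> label s i"
      by (rule kuhn_lemma[of P n label]) (use P zero in \<open>auto simp: label_def\<close>)
    then have ex: "\<exists>r s. near q r \<and> near q s \<and> label r i \<noteq> label s i" if "i < n" for i
      using that unfolding near_def by blast
    have le: "f (pt P s) i \<le> pt P s i" if "near q s" "label s i \<noteq> 0" "i < n" for s i
    proof -
      have *: "\<forall>i<n. s i \<le> P"
        using q that(1) unfolding near_def by (metis Suc_eq_plus1 Suc_leI le_trans)
      show ?thesis
        using into[OF ptQ[OF P *] that(3)] that P
        by (cases "s i = P") (auto simp: label_def pt_def split: if_splits)
    qed
    have ge: "pt P s i \<le> f (pt P s) i" if "label s i = 0" for s i
      using that by (auto simp: label_def split: if_splits)
    have "\<exists>r s. near q r \<and> near q s \<and> pt P r i \<le> f (pt P r) i \<and> f (pt P s) i \<le> pt P s i"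
      if i: "i < n" for i
    proof -
      obtain r s where "near q r" "near q s" "label r i \<noteq> label s i" using ex[OF i] by blast
      moreover have "label r i = 0 \<longleftrightarrow> label s i \<noteq> 0"
        using calculation(3) by (auto simp: label_def split: if_splits)
      ultimately show ?thesis using le[OF _ _ i] ge by blast
    qed
    then show ?thesis using q unfolding P_def by metis
  qed
  then obtain q R S where q: "\<And>p i. i < n \<Longrightarrow> q p i < Suc p"
    and R: "\<And>p i. i < n \<Longrightarrow> near (q p) (R p i)" and S: "\<And>p i. i < n \<Longrightarrow> near (q p) (S p i)"
    and fR: "\<And>p i. i < n \<Longrightarrow> pt (Suc p) (R p i) i \<le> f (pt (Suc p) (R p i)) i"
    and fS: "\<And>p i. i < n \<Longrightarrow> f (pt (Suc p) (S p i)) i \<le> pt (Suc p) (S p i) i"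
    by metis
  have "\<forall>p. pt (Suc p) (q p) \<in> Q"
    using q by (intro allI ptQ) (auto simp: less_imp_le)
  then obtain x \<sigma> where x: "x \<in> Q" and \<sigma>: "strict_mono \<sigma>"
    and lim: "((\<lambda>p. pt (Suc p) (q p)) \<circ> \<sigma>) \<longlonglongrightarrow> x"
    by (rule seq_compactE[OF seq])
  have limc: "(\<lambda>m. pt (Suc (\<sigma> m)) (q (\<sigma> m)) j) \<longlonglongrightarrow> x j" for j
    using lim by (auto simp: o_def tendsto_fun_iff)
  have null: "(\<lambda>m. 1 / real (Suc (\<sigma> m))) \<longlonglongrightarrow> 0"
    using LIMSEQ_subseq_LIMSEQ[OF LIMSEQ_inverse_real_of_nat \<sigma>] by (simp add: o_def inverse_eq_divide)
  \<comment> \<open>Vertices of the small cubes lie within \<open>1/p\<close> of the base points, so they share their limit.\<close>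
  have corner: "(\<lambda>m. pt (Suc (\<sigma> m)) (r (\<sigma> m))) \<longlonglongrightarrow> x \<and> (\<forall>m. pt (Suc (\<sigma> m)) (r (\<sigma> m)) \<in> Q)"
    if r: "\<And>p. near (q p) (r p)" for r
  proof
    show "(\<lambda>m. pt (Suc (\<sigma> m)) (r (\<sigma> m))) \<longlonglongrightarrow> x"
      unfolding tendsto_fun_iff
    proof
      fix j
      have upper: "(\<lambda>m. pt (Suc (\<sigma> m)) (q (\<sigma> m)) j + 1 / real (Suc (\<sigma> m))) \<longlonglongrightarrow> x j"
        using tendsto_add[OF limc null] by simp
      show "(\<lambda>m. pt (Suc (\<sigma> m)) (r (\<sigma> m)) j) \<longlonglongrightarrow> x j"
      proof (rule tendsto_sandwich[OF _ _ limc upper])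
        show "\<forall>\<^sub>F m in sequentially. pt (Suc (\<sigma> m)) (q (\<sigma> m)) j \<le> pt (Suc (\<sigma> m)) (r (\<sigma> m)) j"
          using r by (auto simp: pt_def near_def divide_right_mono)
        have "real (r p j) / real (Suc p) \<le> real (q p j) / real (Suc p) + 1 / real (Suc p)"
          if "j < n" for p
        proof -
          have "real (r p j) \<le> real (q p j) + 1"
            using r[of p] that by (force simp: near_def)
          then show ?thesis by (simp add: divide_right_mono flip: add_divide_distrib)
        qed
        then show "\<forall>\<^sub>F m in sequentially. pt (Suc (\<sigma> m)) (r (\<sigma> m)) j
                     \<le> pt (Suc (\<sigma> m)) (q (\<sigma> m)) j + 1 / real (Suc (\<sigma> m))"
          by (auto simp: pt_def)
      qed
    qed
    show "\<forall>m. pt (Suc (\<sigma> m)) (r (\<sigma> m)) \<in> Q"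
    proof
      fix m
      have "r (\<sigma> m) i \<le> Suc (\<sigma> m)" if "i < n" for i
        using r[of "\<sigma> m"] q[OF that, of "\<sigma> m"] that unfolding near_def by fastforce
      then show "pt (Suc (\<sigma> m)) (r (\<sigma> m)) \<in> Q" by (intro ptQ) auto
    qed
  qed
  have "f x i = x i" if i: "i < n" for i
  proof (rule antisym)
    have *: "(\<lambda>m. f (pt (Suc (\<sigma> m)) (r (\<sigma> m))) i) \<longlonglongrightarrow> f x i"
            "(\<lambda>m. pt (Suc (\<sigma> m)) (r (\<sigma> m)) i) \<longlonglongrightarrow> x i"
      if r: "\<And>p. near (q p) (r p)" for r
    proof -
      note c = corner[of r, OF r]
      show "(\<lambda>m. f (pt (Suc (\<sigma> m)) (r (\<sigma> m))) i) \<longlonglongrightarrow> f x i"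
        by (rule continuous_on_tendsto_compose[OF cont[OF i] conjunct1[OF c] x])
          (simp add: conjunct2[OF c])
      show "(\<lambda>m. pt (Suc (\<sigma> m)) (r (\<sigma> m)) i) \<longlonglongrightarrow> x i"
        using conjunct1[OF c] unfolding tendsto_fun_iff by blast
    qed
    show "f x i \<le> x i"
      by (rule LIMSEQ_le[OF *(1)[of "\<lambda>p. S p i", OF S[OF i]] *(2)[of "\<lambda>p. S p i", OF S[OF i]]]) (use fS[OF i] in auto)
    show "x i \<le> f x i"
      by (rule LIMSEQ_le[OF *(2)[of "\<lambda>p. R p i", OF R[OF i]] *(1)[of "\<lambda>p. R p i", OF R[OF i]]]) (use fR[OF i] in auto)
  qed
  with x show thesis by (rule that)
qed

text \<open>The product of the standard simplices with vertex sets \<open>M i\<close>, \<open>i \<in> J\<close>. Coordinates outside the index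
  set are pinned to 0, which makes a fixed point in it an equality of functions.\<close>

definition simplex_product :: "'i set \<Rightarrow> ('i \<Rightarrow> 'k set) \<Rightarrow> ('i \<times> 'k \<Rightarrow> real) set" where
  "simplex_product J M = {l. (\<forall>i\<in>J. (\<forall>k\<in>M i. 0 \<le> l (i, k)) \<and> (\<Sum>k\<in>M i. l (i, k)) = 1) \<and>
     (\<forall>a. a \<notin> Sigma J M \<longrightarrow> l a = 0)}"

text \<open>The product of simplices is a retract of the unit cube, so Brouwer's theorem passes from the cube to it.\<close>

lemma brouwer_simplex_product:
  fixes f :: "('i \<times> 'k \<Rightarrow> real) \<Rightarrow> 'i \<times> 'k \<Rightarrow> real"
  assumes J: "finite J" and M: "\<And>i. i \<in> J \<Longrightarrow> finite (M i) \<and> M i \<noteq> {}"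
    and cont: "\<And>a. a \<in> Sigma J M \<Longrightarrow> continuous_on (simplex_product J M) (\<lambda>l. f l a)"
    and into: "f ` simplex_product J M \<subseteq> simplex_product J M"
  obtains l where "l \<in> simplex_product J M" "f l = l"
proof -
  define A where "A = Sigma J M"
  have finA: "finite A" using J M by (auto simp: A_def)
  obtain b where b: "bij_betw b {..<card A} A"
    using finA ex_bij_betw_nat_finite[of A] by (auto simp: atLeast0LessThan)
  define n where "n = card A"
  define c where "c = inv_into {..<n} b"
  have c: "c a < n" "b (c a) = a" if "a \<in> A" for a
    using b that unfolding c_def n_def
    by (metis bij_betw_def inv_into_into lessThan_iff, metis bij_betw_inv_into_right)
  have bA: "b i \<in> A" "c (b i) = i" if "i < n" for i
    using b that unfolding c_def n_def
    by (auto simp: bij_betw_def inv_into_f_f)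
  define Q where "Q = Pi\<^sub>E UNIV (\<lambda>i. if i < n then {0..1} else {0::real})"
  have Q: "x \<in> Q \<longleftrightarrow> (\<forall>i<n. 0 \<le> x i \<and> x i \<le> 1) \<and> (\<forall>i\<ge>n. x i = 0)" for x
  proof -
    have "x \<in> Q \<longleftrightarrow> (\<forall>i. x i \<in> (if i < n then {0..1} else {0}))"
      by (simp add: Q_def PiE_iff)
    also have "\<dots> \<longleftrightarrow> (\<forall>i. (i < n \<longrightarrow> 0 \<le> x i \<and> x i \<le> 1) \<and> (i \<ge> n \<longrightarrow> x i = 0))"
      by (rule all_cong1) auto
    finally show ?thesis by blast
  qed
  define s where "s x i = (\<Sum>k\<in>M i. x (c (i, k)))" for x :: "nat \<Rightarrow> real" and i
  \<comment> \<open>The retraction: mass missing from a block is spread evenly over it, surplus mass is scaled away.\<close>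
  define r where "r x = (\<lambda>(i, k). if (i, k) \<in> A
      then (x (c (i, k)) + max 0 (1 - s x i) / real (card (M i))) / max 1 (s x i) else 0)" for x
  have rin: "r x \<in> simplex_product J M" if x: "x \<in> Q" for x
  proof -
    have "0 \<le> r x (i, k)" if "i \<in> J" "k \<in> M i" for i k
      using that x c(1)[of "(i, k)"] by (auto simp: r_def Q A_def)
    moreover have "(\<Sum>k\<in>M i. r x (i, k)) = 1" if i: "i \<in> J" for i
    proof -
      have "(\<Sum>k\<in>M i. r x (i, k))
          = (\<Sum>k\<in>M i. (x (c (i, k)) + max 0 (1 - s x i) / real (card (M i))) / max 1 (s x i))"
        using i by (intro sum.cong) (auto simp: r_def A_def)
      also have "\<dots> = (s x i + max 0 (1 - s x i)) / max 1 (s x i)"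
        using M[OF i] by (simp add: sum_divide_distrib[symmetric] sum.distrib s_def[symmetric])
      also have "\<dots> = 1" by (auto simp: max_def)
      finally show ?thesis .
    qed
    moreover have "r x a = 0" if "a \<notin> Sigma J M" for a
      using that by (cases a) (auto simp: r_def A_def)
    ultimately show ?thesis by (simp add: simplex_product_def)
  qed
  have contr: "continuous_on Q r"
  proof (rule continuous_on_coordinatewise_then_product)
    fix a :: "'i \<times> 'k"
    obtain i k where a: "a = (i, k)" by (cases a)
    have "continuous_on Q (\<lambda>x. s x i)"
      unfolding s_def
      by (intro continuous_on_sum continuous_on_subset[OF continuous_on_product_coordinates]) auto
    then show "continuous_on Q (\<lambda>x. r x a)"
      unfolding r_def a using M[of i]
      by (cases "(i, k) \<in> A")
        (auto intro!: continuous_intros continuous_on_subset[OF continuous_on_product_coordinates]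
          simp: A_def)
  qed
  have unit: "l a \<in> {0..1}" if "l \<in> simplex_product J M" "a \<in> A" for l a
  proof -
    obtain i k where a: "a = (i, k)" by (cases a)
    have i: "i \<in> J" "k \<in> M i" using that a by (auto simp: A_def)
    have "l (i, k) \<le> (\<Sum>k\<in>M i. l (i, k))"
      using that i M[OF i(1)] by (intro member_le_sum) (auto simp: simplex_product_def)
    then show ?thesis using that(1) i a by (auto simp: simplex_product_def)
  qed
  obtain x where x: "x \<in> Q" and fx: "\<And>i. i < n \<Longrightarrow> f (r x) (b i) = x i"
  proof (rule brouwer_nat_cube[of n "\<lambda>x i. f (r x) (b i)", folded Q_def])
    show "continuous_on Q (\<lambda>x. f (r x) (b i))" if "i < n" for i
      using continuous_on_compose2[OF cont[of "b i"] contr] rin bA[OF that] by (auto simp: A_def)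
    show "f (r x) (b i) \<in> {0..1}" if "x \<in> Q" "i < n" for x i
      using unit into rin that bA by blast
  qed (auto)
  have fr: "f (r x) \<in> simplex_product J M" using into rin[OF x] by blast
  have xc: "x (c a) = f (r x) a" if "a \<in> A" for a
    using fx[OF c(1)[OF that]] c(2)[OF that] by simp
  have s1: "s x i = 1" if "i \<in> J" for i
    using fr that xc by (auto simp: s_def simplex_product_def A_def)
  have "f (r x) a = r x a" for a
  proof (cases "a \<in> A")
    case True
    then show ?thesis using xc[OF True] s1 by (auto simp: r_def A_def)
  next
    case False
    then show ?thesis using fr by (auto simp: r_def A_def simplex_product_def split: prod.splits)
  qed
  then have "f (r x) = r x" by (rule ext)
  with rin[OF x] show thesis by (rule that)
qed


section \<open>Selections of weakly naturally quasi-concave correspondences\<close>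

text \<open>Barycentric coordinates are restrictions of affine functionals \<open>L k + d k\<close> on the whole space.
  Affine independence of the vertices is linear independence of their lifts to height 1, and linear
  functionals prescribed on independent vectors extend to everything. Having the coordinates
  as globally defined functionals makes them continuous along any affine parametrization by
  finitely many real numbers, although they need not be continuous in the topology of the space.\<close>

lemma barycentric_coordinates:
  fixes K :: "'z::real_vector set"
  assumes "simplex_on n K"
  obtains x :: "nat \<Rightarrow> 'z" and L :: "nat \<Rightarrow> 'z \<Rightarrow> real" and d :: "nat \<Rightarrow> real"
  where "inj_on x {1..n}" "x ` {1..n} \<subseteq> K" "\<And>k. linear (L k)"
    "\<And>z. z \<in> K \<Longrightarrow> (\<lambda>k. L k z + d k) \<in> std_simplex n"
    "\<And>z. z \<in> K \<Longrightarrow> z = (\<Sum>k=1..n. (L k z + d k) *\<^sub>R x k)"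
proof -
  obtain C where fin: "finite C" and card: "card C = n" and ind: "\<not> affine_dependent C"
    and K: "K = convex hull C"
    using assms unfolding simplex_on_def by blast
  obtain x where x: "bij_betw x {1..n} C"
    using ex_bij_betw_nat_finite_1[OF fin] card by blast
  define S where "S = (\<lambda>c. (c, 1::real)) ` C"
  have inj: "inj_on (\<lambda>c. (c, 1::real)) C" by (auto simp: inj_on_def)
  have "independent S"
  proof
    assume "dependent S"
    then obtain u where u: "\<exists>v\<in>S. u v \<noteq> 0" "(\<Sum>v\<in>S. u v *\<^sub>R v) = 0"
      using fin by (auto simp: S_def dependent_finite)
    have "(\<Sum>c\<in>C. u (c, 1) *\<^sub>R (c, 1::real)) = 0"
      using u(2) inj by (simp add: S_def sum.reindex)
    then have "(\<Sum>c\<in>C. u (c, 1) *\<^sub>R c) = 0" "(\<Sum>c\<in>C. u (c, 1)) = 0"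
      by (auto simp: prod_eq_iff fst_sum snd_sum)
    moreover have "\<exists>v\<in>C. u (v, 1) \<noteq> 0" using u(1) by (auto simp: S_def)
    ultimately show False
      using ind affine_dependent_explicit_finite[OF fin] by blast
  qed
  then have "\<exists>g :: 'z \<times> real \<Rightarrow> real. linear g \<and> (\<forall>s\<in>S. g s = (if s = (x k, 1) then 1 else 0))" for k
    by (rule linear_independent_extend)
  then have "\<forall>k. \<exists>g :: 'z \<times> real \<Rightarrow> real. linear g \<and> (\<forall>s\<in>S. g s = (if s = (x k, 1) then 1 else 0))" ..
  then obtain G :: "nat \<Rightarrow> 'z \<times> real \<Rightarrow> real"
    where "\<forall>k. linear (G k) \<and> (\<forall>s\<in>S. G k s = (if s = (x k, 1) then 1 else 0))"
    unfolding choice_iff ..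
  then have G: "linear (G k)" and Gx: "c \<in> C \<Longrightarrow> G k (c, 1) = (if c = x k then 1 else 0)" for k c
    by (auto simp: S_def)
  define L where "L k z = G k (z, 0)" for k z
  define d where "d k = G k (0, 1)" for k
  have Ld: "L k z + d k = G k (z, 1)" for k z
    using linear_add[OF G, of k "(z, 0)" "(0, 1)"] by (simp add: L_def d_def)
  have lin: "linear (L k)" for k
  proof
    show "L k (a + b) = L k a + L k b" for a b
      using linear_add[OF G, of k "(a, 0)" "(b, 0)"] by (simp add: L_def)
    show "L k (r *\<^sub>R a) = r *\<^sub>R L k a" for r a
      using linear_scale[OF G, of k r "(a, 0)"] by (simp add: L_def)
  qed
  have coord: "(\<lambda>k. L k z + d k) \<in> std_simplex n \<and> z = (\<Sum>k=1..n. (L k z + d k) *\<^sub>R x k)"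
    if zK: "z \<in> K" for z
  proof -
    obtain u where u: "\<forall>c\<in>C. 0 \<le> u c" "sum u C = 1" "(\<Sum>c\<in>C. u c *\<^sub>R c) = z"
      using zK unfolding K convex_hull_finite[OF fin] by blast
    have z: "(z, 1) = (\<Sum>c\<in>C. u c *\<^sub>R (c, 1::real))"
      using u by (simp add: prod_eq_iff fst_sum snd_sum)
    have uk: "L k z + d k = u (x k)" if k: "k \<in> {1..n}" for k
    proof -
      have xk: "x k \<in> C" using x k by (auto simp: bij_betw_def)
      have "L k z + d k = (\<Sum>c\<in>C. G k (u c *\<^sub>R (c, 1::real)))"
        unfolding Ld z by (rule linear_sum[OF G])
      also have "\<dots> = (\<Sum>c\<in>C. if c = x k then u c else 0)"
        by (intro sum.cong refl) (simp add: linear_scale[OF G] Gx del: scaleR_Pair)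
      finally show ?thesis using fin xk by simp
    qed
    have "(\<Sum>k=1..n. u (x k)) = 1" "(\<Sum>k=1..n. u (x k) *\<^sub>R x k) = z"
      using u sum.reindex_bij_betw[OF x, of u] sum.reindex_bij_betw[OF x, of "\<lambda>c. u c *\<^sub>R c"] by auto
    moreover have "0 \<le> u (x k)" if "k \<in> {1..n}" for k
      using u x that by (auto simp: bij_betw_def)
    ultimately show ?thesis by (simp add: std_simplex_def uk)
  qed
  show thesis
  proof (rule that[of x L d])
    show "x ` {1..n} \<subseteq> K"
      using x by (auto simp: K bij_betw_def hull_inc)
  qed (use x lin coord in \<open>auto simp: bij_betw_def\<close>)
qed

text \<open>Applying weak natural quasi-concavity to the vertices of the simplex gives a selection that is
  a continuous function of the barycentric coordinates. The functions \<open>\<gamma> k\<close> are the given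
  functions on the unit interval, extended by constants: then they can be composed with the
  global functionals \<open>L k + d k\<close>, which may leave the unit interval outside \<open>K\<close>.\<close>

lemma WNQ_selection:
  fixes K :: "'z::real_vector set" and T :: "'z \<Rightarrow> 'y::real_vector set"
  assumes "simplex_on n K" and "weakly_naturally_quasi_concave K T"
  obtains y :: "nat \<Rightarrow> 'y" and \<gamma> :: "nat \<Rightarrow> real \<Rightarrow> real" and L :: "nat \<Rightarrow> 'z \<Rightarrow> real" and d :: "nat \<Rightarrow> real"
  where "\<And>k. k \<in> {1..n} \<Longrightarrow> \<exists>z\<in>K. y k \<in> T z" "\<And>k. linear (L k)"
    "\<And>k. k \<in> {1..n} \<Longrightarrow> continuous_on UNIV (\<gamma> k)"
    "\<And>k t. k \<in> {1..n} \<Longrightarrow> 0 \<le> \<gamma> k t"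
    "\<And>z. z \<in> K \<Longrightarrow> (\<Sum>k=1..n. \<gamma> k (L k z + d k)) = 1"
    "\<And>z. z \<in> K \<Longrightarrow> (\<Sum>k=1..n. \<gamma> k (L k z + d k) *\<^sub>R y k) \<in> T z"
proof -
  obtain x L d where x: "inj_on x {1..n}" "x ` {1..n} \<subseteq> K" and lin: "\<And>k::nat. linear (L k)"
    and simplex: "\<And>z. z \<in> K \<Longrightarrow> (\<lambda>k. L k z + d k) \<in> std_simplex n"
    and bary: "\<And>z. z \<in> K \<Longrightarrow> z = (\<Sum>k=1..n. (L k z + d k) *\<^sub>R x k)"
    by (rule barycentric_coordinates[OF assms(1)]) (rule that)
  have "\<exists>(y :: nat \<Rightarrow> 'y) g. (\<forall>k\<in>{1..n}. y k \<in> T (x k)) \<and>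
      (\<forall>k\<in>{1..n}. continuous_on {0..1} (g k) \<and> g k ` {0..1} \<subseteq> {0..1} \<and> g k 0 = 0 \<and> g k 1 = (1::real)) \<and>
      (\<forall>l\<in>std_simplex n. (\<lambda>k. g k (l k)) \<in> std_simplex n) \<and>
      (\<forall>l\<in>std_simplex n. (\<Sum>k=1..n. g k (l k) *\<^sub>R y k) \<in> T (\<Sum>k=1..n. l k *\<^sub>R x k))"
    using assms(2)[unfolded weakly_naturally_quasi_concave_def, THEN spec, THEN spec, THEN mp, OF conjI[OF x]] .
  then obtain y g where y: "\<forall>k\<in>{1..n}. y k \<in> T (x k)"
    and g: "\<forall>k\<in>{1..n}. continuous_on {0..1} (g k) \<and> g k ` {0..1} \<subseteq> {0..1} \<and> g k 0 = 0 \<and> g k 1 = (1::real)"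
    and g1: "\<forall>l\<in>std_simplex n. (\<lambda>k. g k (l k)) \<in> std_simplex n"
    and gT: "\<forall>l\<in>std_simplex n. (\<Sum>k=1..n. g k (l k) *\<^sub>R y k) \<in> T (\<Sum>k=1..n. l k *\<^sub>R x k)"
    by (elim exE conjE)
  define \<gamma> where "\<gamma> k t = g k (max 0 (min 1 t))" for k t
  have le1: "l k \<le> 1" if "l \<in> std_simplex n" "k \<in> {1..n}" for l k
    using that member_le_sum[of k "{1..n}" l] by (auto simp: std_simplex_def)
  have \<gamma>: "\<gamma> k (L k z + d k) = g k (L k z + d k)" if "z \<in> K" "k \<in> {1..n}" for z k
  proof -
    have "0 \<le> L k z + d k" using simplex[OF that(1)] that(2) by (simp add: std_simplex_def)
    then show ?thesis using le1[OF simplex[OF that(1)] that(2)] by (simp add: \<gamma>_def)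
  qed
  show thesis
  proof (rule that[of y L \<gamma> d])
    show "\<exists>z\<in>K. y k \<in> T z" if "k \<in> {1..n}" for k using y x(2) that by blast
    show "continuous_on UNIV (\<gamma> k)" if "k \<in> {1..n}" for k
    proof -
      have "continuous_on {0..1} (g k)" using g that by blast
      moreover have "continuous_on UNIV (\<lambda>t::real. max 0 (min 1 t))" by (intro continuous_intros)
      ultimately show ?thesis
        unfolding \<gamma>_def by (rule continuous_on_compose2) auto
    qed
    show "0 \<le> \<gamma> k t" if "k \<in> {1..n}" for k t
    proof -
      have "g k ` {0..1} \<subseteq> {0..1}" using g that by blast
      moreover have "max 0 (min 1 t) \<in> {0..1}" by auto
      ultimately have "\<gamma> k t \<in> {0..1}" unfolding \<gamma>_def by blast
      then show ?thesis by simp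
    qed
    show "(\<Sum>k=1..n. \<gamma> k (L k z + d k)) = 1" if "z \<in> K" for z
    proof -
      have "(\<Sum>k=1..n. g k (L k z + d k)) = 1"
        using g1 simplex[OF that] by (force simp: std_simplex_def)
      then show ?thesis using \<gamma>[OF that] by simp
    qed
    show "(\<Sum>k=1..n. \<gamma> k (L k z + d k) *\<^sub>R y k) \<in> T z" if "z \<in> K" for z
    proof -
      have "(\<Sum>k=1..n. g k (L k z + d k) *\<^sub>R y k) \<in> T z"
        using gT simplex[OF that] bary[OF that] by force
      then show ?thesis using \<gamma>[OF that] by simp
    qed
  qed (rule lin)
qed


section \<open>Topological vector spaces\<close>

lemma continuous_map_tvs_add:
  assumes "topological_vector_space E" "continuous_map Z E f" "continuous_map Z E g"
  shows "continuous_map Z E (\<lambda>z. f z + g z)"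
proof -
  have "continuous_map Z E ((\<lambda>(x, y). x + y) \<circ> (\<lambda>z. (f z, g z)))"
    using assms unfolding topological_vector_space_def
    by (intro continuous_map_compose[of _ "prod_topology E E"] continuous_map_pairedI) auto
  then show ?thesis by (simp add: o_def)
qed

lemma continuous_map_tvs_scaleR:
  assumes "topological_vector_space E" "continuous_map Z euclideanreal c" "continuous_map Z E f"
  shows "continuous_map Z E (\<lambda>z. c z *\<^sub>R f z)"
proof -
  have "continuous_map Z E ((\<lambda>(c, x). c *\<^sub>R x) \<circ> (\<lambda>z. (c z, f z)))"
    using assms unfolding topological_vector_space_def
    by (intro continuous_map_compose[of _ "prod_topology euclideanreal E"] continuous_map_pairedI) auto
  then show ?thesis by (simp add: o_def)
qed

lemma tvs_zero_in: "topological_vector_space E \<Longrightarrow> 0 \<in> topspace E"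
  by (simp add: topological_vector_space_def subspace_0)

lemma continuous_map_tvs_sum:
  assumes "topological_vector_space E" "finite A" "\<And>a. a \<in> A \<Longrightarrow> continuous_map Z E (f a)"
  shows "continuous_map Z E (\<lambda>z. \<Sum>a\<in>A. f a z)"
  using assms(2,3)
proof (induction A)
  case empty
  then show ?case using tvs_zero_in[OF assms(1)] by simp
next
  case (insert a A)
  then show ?case by (simp add: continuous_map_tvs_add[OF assms(1)])
qed

lemma continuous_map_tvs_diff:
  assumes "topological_vector_space E" "continuous_map Z E f" "continuous_map Z E g"
  shows "continuous_map Z E (\<lambda>z. f z - g z)"
  using continuous_map_tvs_add[OF assms(1,2) continuous_map_tvs_scaleR[OF assms(1) _ assms(3), of "\<lambda>_. -1"]]
  by simp

lemma openin_tvs_translation: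
  assumes "topological_vector_space E" "openin E U" "a \<in> topspace E"
  shows "openin E {y \<in> topspace E. y - a \<in> U}"
  using assms
  by (intro openin_continuous_map_preimage[of E E "\<lambda>y. y - a"] continuous_map_tvs_diff) auto

lemma openin_prod_topologyE:
  assumes "openin (prod_topology X Y) S" "(x, y) \<in> S"
  obtains U V where "openin X U" "openin Y V" "x \<in> U" "y \<in> V" "U \<times> V \<subseteq> S"
  using assms unfolding openin_prod_topology_alt by meson

lemma tvs_diff_neighborhoods:
  assumes E: "topological_vector_space E" and G: "openin E G" "a \<in> G"
  obtains U V where "openin E U" "0 \<in> U" "openin E V" "0 \<in> V"
    "\<And>u v. u \<in> U \<Longrightarrow> v \<in> V \<Longrightarrow> a + u - v \<in> G"
proof -
  have a: "a \<in> topspace E" using G openin_subset by blast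
  define S where "S = {p \<in> topspace (prod_topology E E). a + fst p - snd p \<in> G}"
  have "continuous_map (prod_topology E E) E (\<lambda>p. a + fst p - snd p)"
    using a by (intro continuous_map_tvs_diff[OF E] continuous_map_tvs_add[OF E]
        continuous_map_fst continuous_map_snd) simp
  then have "openin (prod_topology E E) S"
    unfolding S_def using G(1) by (rule openin_continuous_map_preimage)
  moreover have "(0, 0) \<in> S" using G tvs_zero_in[OF E] by (simp add: S_def)
  ultimately obtain U V where "openin E U" "openin E V" "0 \<in> U" "0 \<in> V" "U \<times> V \<subseteq> S"
    by (rule openin_prod_topologyE)
  then show thesis by (intro that[of U V]) (auto simp: S_def)
qed

text \<open>If \<open>a \<notin> C\<close>, then \<open>a + u - v\<close> stays outside the closed set \<open>C\<close> for small \<open>u\<close> and \<open>v\<close>, so \<open>a + U\<close> and \<open>C + V\<close>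
  are disjoint. Compactness and regularity of the profile space then yield Urysohn functions on it,
  although it need not be Hausdorff.\<close>

lemma tvs_regular_space:
  assumes E: "topological_vector_space E"
  shows "regular_space E"
  unfolding regular_space_def
proof (intro allI impI)
  fix C a assume *: "closedin E C \<and> a \<in> topspace E - C"
  then have "openin E (topspace E - C)" "a \<in> topspace E - C" by auto
  then obtain U V where U: "openin E U" "0 \<in> U" and V: "openin E V" "0 \<in> V"
    and UV: "\<And>u v. u \<in> U \<Longrightarrow> v \<in> V \<Longrightarrow> a + u - v \<in> topspace E - C"
    using tvs_diff_neighborhoods[OF E] by metis
  have C: "C \<subseteq> topspace E" using * closedin_subset by blast
  define U' where "U' = {y \<in> topspace E. y - a \<in> U}"
  define V' where "V' = (\<Union>c\<in>C. {y \<in> topspace E. y - c \<in> V})"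
  have "openin E U'" "openin E V'"
    unfolding U'_def V'_def using * U V C
    by (auto intro!: openin_tvs_translation[OF E] openin_Union)
  moreover have "a \<in> U'" "C \<subseteq> V'" using * U V C by (auto simp: U'_def V'_def)
  moreover have "y \<notin> V'" if "y \<in> U'" for y
  proof
    assume "y \<in> V'"
    then obtain c where c: "c \<in> C" "y - c \<in> V" by (auto simp: V'_def)
    then show False using UV[of "y - a" "y - c"] that by (auto simp: U'_def)
  qed
  ultimately show "\<exists>U V. openin E U \<and> openin E V \<and> a \<in> U \<and> C \<subseteq> V \<and> disjnt U V"
    by (auto simp: disjnt_iff)
qed

lemma locally_convex_half_neighborhood:
  assumes E: "locally_convex_space E" and V: "neighborhood_of_zero E V"
  obtains V' where "neighborhood_of_zero E V'" "convex V'"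
    "\<And>u v. u \<in> V' \<Longrightarrow> v \<in> V' \<Longrightarrow> u + v \<in> V"
proof -
  have E': "topological_vector_space E" using E by (simp add: locally_convex_space_def)
  obtain U where U: "openin E U" "0 \<in> U" "U \<subseteq> V"
    using V by (auto simp: neighborhood_of_zero_def)
  define S where "S = {p \<in> topspace (prod_topology E E). fst p + snd p \<in> U}"
  have "continuous_map (prod_topology E E) E (\<lambda>p. fst p + snd p)"
    by (intro continuous_map_tvs_add[OF E'] continuous_map_fst continuous_map_snd)
  then have "openin (prod_topology E E) S"
    unfolding S_def using U(1) by (rule openin_continuous_map_preimage)
  moreover have "(0, 0) \<in> S" using U tvs_zero_in[OF E'] by (simp add: S_def)
  ultimately obtain A B where AB: "openin E A" "openin E B" "0 \<in> A" "0 \<in> B" "A \<times> B \<subseteq> S"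
    by (rule openin_prod_topologyE)
  then have "neighborhood_of_zero E (A \<inter> B)"
    unfolding neighborhood_of_zero_def using openin_subset[of E "A \<inter> B"] by blast
  then obtain V' where V': "neighborhood_of_zero E V'" "convex V'" "V' \<subseteq> A \<inter> B"
    using E unfolding locally_convex_space_def by blast
  show thesis
    using V' AB U by (intro that[of V']) (blast, blast, fastforce simp: S_def)
qed

lemma neighborhood_of_zero_Inter:
  assumes E: "topological_vector_space E" and "finite A" "\<And>a. a \<in> A \<Longrightarrow> neighborhood_of_zero E (V a)"
  shows "neighborhood_of_zero E (topspace E \<inter> (\<Inter>a\<in>A. V a))"
  using assms(2,3)
proof (induction A)
  case empty
  then show ?case using tvs_zero_in[OF E] by (auto simp: neighborhood_of_zero_def)
next
  case (insert a A)
  then have "neighborhood_of_zero E (V a)" "neighborhood_of_zero E (topspace E \<inter> (\<Inter>a\<in>A. V a))"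
    by auto
  then obtain U U' where "openin E U" "0 \<in> U" "U \<subseteq> V a"
    "openin E U'" "0 \<in> U'" "U' \<subseteq> topspace E \<inter> (\<Inter>a\<in>A. V a)"
    unfolding neighborhood_of_zero_def by blast
  then show ?case unfolding neighborhood_of_zero_def
    by (intro conjI exI[of _ "U \<inter> U'"] openin_Int) auto
qed


section \<open>Partitions of unity on compact regular spaces\<close>

lemma compact_space_neighborhood_subcover:
  assumes "compact_space Y" and U: "\<And>z. z \<in> topspace Y \<Longrightarrow> openin Y (U z) \<and> z \<in> U z"
  obtains A where "finite A" "A \<subseteq> topspace Y" "topspace Y \<subseteq> (\<Union>a\<in>A. U a)"
proof -
  have "(\<forall>G\<in>U ` topspace Y. openin Y G) \<and> topspace Y \<subseteq> \<Union>(U ` topspace Y)"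
    using U by blast
  then obtain \<F> where "finite \<F>" "\<F> \<subseteq> U ` topspace Y" "topspace Y \<subseteq> \<Union>\<F>"
    using assms(1) unfolding compact_space_alt by meson
  then show thesis using that finite_subset_image by metis
qed

text \<open>A barycentric refinement: all indices \<open>z\<close> that are active at \<open>x\<close> lie in one common set \<open>U a\<close> which also
  contains \<open>x\<close>. Take finitely many continuous functions \<open>u a\<close> that are 0 at \<open>a\<close> and 1 off \<open>U a\<close>, and
  whose sets \<open>u a < 1/2\<close> cover the space. If \<open>u a x < 1/2\<close> and \<open>z\<close> has distance below \<open>1/2\<close> from \<open>x\<close> in the
  pseudometric that these functions define, then \<open>u a z < 1\<close>, so \<open>z \<in> U a\<close>. The partition is subordinate to
  finitely many balls of radius \<open>1/2\<close> of this pseudometric.\<close>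

lemma star_refining_partition_of_unity:
  assumes comp: "compact_space Y" and reg: "regular_space Y"
    and U: "\<And>z. z \<in> topspace Y \<Longrightarrow> openin Y (U z) \<and> z \<in> U z"
  obtains Z and \<phi> :: "'a \<Rightarrow> 'a \<Rightarrow> real"
  where "finite Z" "Z \<subseteq> topspace Y"
    "\<And>z. z \<in> Z \<Longrightarrow> continuous_map Y euclideanreal (\<phi> z)"
    "\<And>z x. x \<in> topspace Y \<Longrightarrow> 0 \<le> \<phi> z x"
    "\<And>x. x \<in> topspace Y \<Longrightarrow> (\<Sum>z\<in>Z. \<phi> z x) = 1"
    "\<And>x. x \<in> topspace Y \<Longrightarrow> \<exists>a\<in>topspace Y. x \<in> U a \<and> (\<forall>z\<in>Z. \<phi> z x \<noteq> 0 \<longrightarrow> z \<in> U a)"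
proof -
  have "completely_regular_space Y"
    using comp reg compact_imp_locally_compact_space locally_compact_regular_imp_completely_regular_space
    by blast
  then have "\<exists>f. continuous_map Y euclideanreal f \<and> f z = 0 \<and> f ` (topspace Y - U z) \<subseteq> {1}"
    if "z \<in> topspace Y" for z
    using U[OF that] unfolding completely_regular_space_alt' by blast
  then obtain u where u: "\<And>z. z \<in> topspace Y \<Longrightarrow> continuous_map Y euclideanreal (u z)"
    and u0: "\<And>z. z \<in> topspace Y \<Longrightarrow> u z z = 0"
    and u1: "\<And>z x. z \<in> topspace Y \<Longrightarrow> x \<in> topspace Y - U z \<Longrightarrow> u z x = (1::real)"
    unfolding image_subset_iff singleton_iff by metis
  obtain A where A: "finite A" "A \<subseteq> topspace Y"
    and Acov: "topspace Y \<subseteq> (\<Union>a\<in>A. {x \<in> topspace Y. u a x \<in> {..<1/2}})"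
  proof (rule compact_space_neighborhood_subcover[OF comp])
    show "openin Y {x \<in> topspace Y. u z x \<in> {..<1/2}} \<and> z \<in> {x \<in> topspace Y. u z x \<in> {..<1/2}}"
      if "z \<in> topspace Y" for z
      using openin_continuous_map_preimage[OF u[OF that], of "{..<1/2}"] u0[OF that] that by simp
  qed
  define d where "d z x = (\<Sum>a\<in>A. \<bar>u a z - u a x\<bar>)" for z x
  have d: "continuous_map Y euclideanreal (d z)" for z
    unfolding d_def using A u by (intro continuous_intros) auto
  obtain Z where Z: "finite Z" "Z \<subseteq> topspace Y"
    and Zcov: "topspace Y \<subseteq> (\<Union>z\<in>Z. {x \<in> topspace Y. d z x \<in> {..<1/2}})"
  proof (rule compact_space_neighborhood_subcover[OF comp])
    show "openin Y {x \<in> topspace Y. d z x \<in> {..<1/2}} \<and> z \<in> {x \<in> topspace Y. d z x \<in> {..<1/2}}"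
      if "z \<in> topspace Y" for z
      using openin_continuous_map_preimage[OF d, of "{..<1/2}"] that by (simp add: d_def)
  qed
  define \<psi> where "\<psi> z x = max 0 (1/2 - d z x)" for z x
  have \<psi>: "continuous_map Y euclideanreal (\<psi> z)" for z
    unfolding \<psi>_def by (intro continuous_intros d) auto
  have pos: "0 < (\<Sum>z\<in>Z. \<psi> z x)" if "x \<in> topspace Y" for x
  proof -
    obtain z where "z \<in> Z" "d z x < 1/2" using Zcov \<open>x \<in> topspace Y\<close> by auto
    then show ?thesis using Z by (intro sum_pos2[of Z z]) (auto simp: \<psi>_def)
  qed
  define \<phi> where "\<phi> z x = \<psi> z x / (\<Sum>w\<in>Z. \<psi> w x)" for z x
  show thesis
  proof (rule that[OF Z, of \<phi>])
    show "continuous_map Y euclideanreal (\<phi> z)" if "z \<in> Z" for z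
      unfolding \<phi>_def using Z pos by (intro continuous_intros \<psi>) (auto dest!: less_imp_neq[OF pos])
    show "0 \<le> \<phi> z x" if "x \<in> topspace Y" for z x
      using pos[OF that] by (simp add: \<phi>_def \<psi>_def)
    show "(\<Sum>z\<in>Z. \<phi> z x) = 1" if "x \<in> topspace Y" for x
      using pos[OF that] by (simp add: \<phi>_def flip: sum_divide_distrib)
    show "\<exists>a\<in>topspace Y. x \<in> U a \<and> (\<forall>z\<in>Z. \<phi> z x \<noteq> 0 \<longrightarrow> z \<in> U a)" if x: "x \<in> topspace Y" for x
    proof -
      obtain a where a: "a \<in> A" "u a x < 1/2" using Acov x by auto
      then have aY: "a \<in> topspace Y" using A by blast
      have "x \<in> U a" using u1[OF aY, of x] a x by auto
      moreover have "z \<in> U a" if z: "z \<in> Z" "\<phi> z x \<noteq> 0" for z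
      proof -
        have "d z x < 1/2" using z(2) by (auto simp: \<phi>_def \<psi>_def max_def split: if_splits)
        moreover have "\<bar>u a z - u a x\<bar> \<le> d z x"
          unfolding d_def using A a by (intro member_le_sum) auto
        ultimately have "u a z < 1" using a by linarith
        then show ?thesis using u1[OF aY, of z] z Z by fastforce
      qed
      ultimately show ?thesis using aY by blast
    qed
  qed
qed


section \<open>Fixed points in products of polytopes\<close>

text \<open>Continuity into the join of the topology of \<open>Y\<close> with the weak topology of all linear functionals,
  continuous or not. Parametrizations of polytopes have this property, and barycentric coordinates
  become continuous after composition with such maps.\<close>

definition linearly_continuous_map :: "'p topology \<Rightarrow> 'z::real_vector topology \<Rightarrow> ('p \<Rightarrow> 'z) \<Rightarrow> bool" where
  "linearly_continuous_map \<Lambda> Y m \<longleftrightarrow> continuous_map \<Lambda> Y m \<and>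
     (\<forall>L :: 'z \<Rightarrow> real. linear L \<longrightarrow> continuous_map \<Lambda> euclideanreal (\<lambda>l. L (m l)))"

lemma sum_fun_apply: "(\<Sum>a\<in>A. f a) x = (\<Sum>a\<in>A. f a x)"
  by (induction A rule: infinite_finite_induct) auto

text \<open>Only the coordinates in the finite set \<open>J\<close> move, each in the polytope spanned by \<open>c i k\<close>; the others are
  frozen at \<open>p\<close>. The weights \<open>l\<close> range over a product of simplices, and a fixed point of \<open>l \<mapsto> w (m l)\<close> gives
  the profile. One has to solve for the weights and not for the profile, because the \<open>w i k\<close> are
  only assumed continuous after composition with a parametrization.\<close>

lemma polytopes_fixed_point:
  fixes E :: "'i \<Rightarrow> 'e::real_vector topology" and c :: "'i \<Rightarrow> 'k \<Rightarrow> 'e"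
    and w :: "'i \<Rightarrow> 'k \<Rightarrow> ('i \<Rightarrow> 'e) \<Rightarrow> real"
  assumes E: "\<And>i. topological_vector_space (E i)"
    and X: "\<And>i. convex (X i)" "\<And>i. X i \<subseteq> topspace (E i)" and p: "p \<in> profiles X"
    and J: "finite J" and M: "\<And>i. i \<in> J \<Longrightarrow> finite (M i) \<and> M i \<noteq> {}"
    and c: "\<And>i k. i \<in> J \<Longrightarrow> k \<in> M i \<Longrightarrow> c i k \<in> X i"
    and nonneg: "\<And>i k x. i \<in> J \<Longrightarrow> k \<in> M i \<Longrightarrow> x \<in> profiles X \<Longrightarrow> 0 \<le> w i k x"
    and sum1: "\<And>i x. i \<in> J \<Longrightarrow> x \<in> profiles X \<Longrightarrow> (\<Sum>k\<in>M i. w i k x) = 1"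
    and cont: "\<And>i k (\<Lambda> :: ('i \<times> 'k \<Rightarrow> real) topology) m. i \<in> J \<Longrightarrow> k \<in> M i \<Longrightarrow>
        linearly_continuous_map \<Lambda> (profile_top E X) m \<Longrightarrow>
        continuous_map \<Lambda> euclideanreal (\<lambda>l. w i k (m l))"
  obtains x where "x \<in> profiles X" "\<And>i. i \<in> J \<Longrightarrow> x i = (\<Sum>k\<in>M i. w i k x *\<^sub>R c i k)"
proof -
  define m where "m l = (\<lambda>i. if i \<in> J then \<Sum>k\<in>M i. l (i, k) *\<^sub>R c i k else p i)" for l
  define \<Lambda> where "\<Lambda> = top_of_set (simplex_product J M)"
  have mX: "m l \<in> profiles X" if l: "l \<in> simplex_product J M" for l
  proof -
    have "m l i \<in> X i" for i
    proof (cases "i \<in> J")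
      case True
      then show ?thesis
        unfolding m_def using l M[OF True] c[OF True]
        by (auto simp: simplex_product_def intro!: convex_sum X)
    next
      case False
      then show ?thesis using p by (auto simp: m_def)
    qed
    then show ?thesis by auto
  qed
  have coord: "continuous_map \<Lambda> euclideanreal (\<lambda>l. l a)" for a
    unfolding \<Lambda>_def continuous_map_iff_continuous
    by (rule continuous_on_subset[OF continuous_on_product_coordinates]) simp
  have "continuous_map \<Lambda> (profile_top E X) m"
    unfolding continuous_map_componentwise_UNIV
  proof
    fix i
    have "continuous_map \<Lambda> (E i) (\<lambda>l. m l i)"
    proof (cases "i \<in> J")
      case True
      have "continuous_map \<Lambda> (E i) (\<lambda>l. \<Sum>k\<in>M i. l (i, k) *\<^sub>R c i k)"
        using M[OF True] c[OF True] X(2)[of i]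
        by (intro continuous_map_tvs_sum[OF E] continuous_map_tvs_scaleR[OF E] coord) auto
      then show ?thesis using True by (simp add: m_def)
    next
      case False
      then show ?thesis using p X(2)[of i] by (auto simp: m_def)
    qed
    then show "continuous_map \<Lambda> (action_top E X i) (\<lambda>l. m l i)"
      using mX by (auto simp: continuous_map_in_subtopology \<Lambda>_def)
  qed
  moreover have "continuous_map \<Lambda> euclideanreal (\<lambda>l. L (m l))"
    if L: "linear L" for L :: "('i \<Rightarrow> 'e) \<Rightarrow> real"
  proof -
    \<comment> \<open>The profile \<open>m l\<close> is affine in finitely many coordinates of \<open>l\<close>, hence so is every \<open>L (m l)\<close>.\<close>
    define e where "e i k = (\<lambda>j. if j = i then c i k else 0)" for i k
    define b where "b = (\<lambda>j. if j \<in> J then 0 else p j)"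
    have "m l = b + (\<Sum>i\<in>J. \<Sum>k\<in>M i. l (i, k) *\<^sub>R e i k)" for l
    proof
      fix j
      have "(\<Sum>i\<in>J. \<Sum>k\<in>M i. l (i, k) *\<^sub>R e i k j) =
          (\<Sum>i\<in>J. if i = j then \<Sum>k\<in>M i. l (i, k) *\<^sub>R c i k else 0)"
        by (intro sum.cong refl) (auto simp: e_def)
      then show "m l j = (b + (\<Sum>i\<in>J. \<Sum>k\<in>M i. l (i, k) *\<^sub>R e i k)) j"
        using J by (simp add: m_def b_def sum_fun_apply scaleR_fun_def)
    qed
    then have "L (m l) = L b + (\<Sum>i\<in>J. \<Sum>k\<in>M i. l (i, k) * L (e i k))" for l
      by (simp add: linear_add[OF L] linear_sum[OF L] linear_scale[OF L])
    moreover have "continuous_map \<Lambda> euclideanreal (\<lambda>l. L b + (\<Sum>i\<in>J. \<Sum>k\<in>M i. l (i, k) * L (e i k)))"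
      using J M by (intro continuous_intros coord) auto
    ultimately show ?thesis by simp
  qed
  ultimately have m: "linearly_continuous_map \<Lambda> (profile_top E X) m"
    by (simp add: linearly_continuous_map_def)
  define f where "f l = (\<lambda>(i, k). if (i, k) \<in> Sigma J M then w i k (m l) else 0)" for l
  obtain l where l: "l \<in> simplex_product J M" "f l = l"
  proof (rule brouwer_simplex_product[OF J, of M f])
    show "continuous_on (simplex_product J M) (\<lambda>l. f l a)" if a: "a \<in> Sigma J M" for a
    proof -
      have "continuous_map \<Lambda> euclideanreal (\<lambda>l. w (fst a) (snd a) (m l))"
        using a by (intro cont m) auto
      then show ?thesis
        using a by (auto simp: f_def \<Lambda>_def continuous_map_iff_continuous split: prod.splits)
    qed
    show "f ` simplex_product J M \<subseteq> simplex_product J M"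
    proof (rule image_subsetI)
      fix l assume "l \<in> simplex_product J M"
      then show "f l \<in> simplex_product J M"
        using nonneg sum1 mX by (auto simp: f_def simplex_product_def)
    qed
  qed (use M in auto)
  show thesis
  proof (rule that[of "m l"])
    show "m l i = (\<Sum>k\<in>M i. w i k (m l) *\<^sub>R c i k)" if i: "i \<in> J" for i
    proof -
      have "l (i, k) = w i k (m l)" if "k \<in> M i" for k
        using fun_cong[OF l(2), of "(i, k)"] i that by (simp add: f_def)
      then show ?thesis using i by (simp add: m_def)
    qed
  qed (rule mX[OF l(1)])
qed


section \<open>Approximate equilibria\<close>

text \<open>For one agent: a map, written with weights \<open>w\<close> on finitely many points \<open>c\<close>, that is an exact selection
  of \<open>T\<close> on the closed set \<open>D\<close> and everywhere approximates the graph of \<open>F\<close>. It interpolates, by a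
  Urysohn function \<open>r\<close> that is 1 on \<open>D\<close> and 0 off \<open>W\<close>, between the selection \<open>f\<close> of \<open>T\<close> coming from weak
  natural quasi-concavity and the partition-of-unity average \<open>g\<close> of values of \<open>F\<close>. Since \<open>r\<close> vanishes
  off \<open>K\<close>, the weights of \<open>f\<close> may be anything there.
  Near a point \<open>a\<close>, the map \<open>f\<close> costs two errors from \<open>N\<close>, one for \<open>T\<close> against \<open>F x\<close> and one for \<open>F x\<close> against
  \<open>F a\<close>, while \<open>g\<close> costs one; this is why \<open>N + N\<close> has to fit into \<open>V\<close>.\<close>

lemma blended_selection:
  fixes Y :: "'z::real_vector topology" and F T :: "'z \<Rightarrow> 'e::real_vector set"
    and \<phi> :: "'z \<Rightarrow> 'z \<Rightarrow> real"
  assumes Y: "normal_space Y" "closedin Y D" "openin Y W" "D \<subseteq> W" "W \<subseteq> K"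
    and K: "simplex_on n K" and T: "weakly_naturally_quasi_concave K T"
    and TF: "\<And>x. x \<in> K \<Longrightarrow> T x \<subseteq> {c + v | c v. c \<in> F x \<and> v \<in> N}"
    and N: "convex N" "0 \<in> N" "\<And>u v. u \<in> N \<Longrightarrow> v \<in> N \<Longrightarrow> u + v \<in> V"
    and Z: "finite Z" and F: "\<And>z. z \<in> Z \<Longrightarrow> F z \<noteq> {}" "\<And>a. a \<in> topspace Y \<Longrightarrow> convex (F a)"
    and \<phi>: "\<And>z. z \<in> Z \<Longrightarrow> continuous_map Y euclideanreal (\<phi> z)"
    "\<And>z x. x \<in> topspace Y \<Longrightarrow> 0 \<le> \<phi> z x"
    "\<And>x. x \<in> topspace Y \<Longrightarrow> (\<Sum>z\<in>Z. \<phi> z x) = 1"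
  obtains I :: "(nat + 'z) set" and c :: "nat + 'z \<Rightarrow> 'e" and w :: "nat + 'z \<Rightarrow> 'z \<Rightarrow> real"
  where "finite I" "\<And>k. k \<in> I \<Longrightarrow> c k \<in> (\<Union>x\<in>K. T x) \<union> (\<Union>z\<in>Z. F z)"
    "\<And>k x. k \<in> I \<Longrightarrow> x \<in> topspace Y \<Longrightarrow> 0 \<le> w k x"
    "\<And>x. x \<in> topspace Y \<Longrightarrow> (\<Sum>k\<in>I. w k x) = 1"
    "\<And>k (\<Lambda> :: 'p topology) m. k \<in> I \<Longrightarrow> linearly_continuous_map \<Lambda> Y m \<Longrightarrow>
       continuous_map \<Lambda> euclideanreal (\<lambda>l. w k (m l))"
    "\<And>x. x \<in> D \<Longrightarrow> (\<Sum>k\<in>I. w k x *\<^sub>R c k) \<in> T x"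
    "\<And>x a. x \<in> topspace Y \<Longrightarrow> a \<in> topspace Y \<Longrightarrow> F x \<subseteq> {c + v | c v. c \<in> F a \<and> v \<in> N} \<Longrightarrow>
       (\<And>z. z \<in> Z \<Longrightarrow> \<phi> z x \<noteq> 0 \<Longrightarrow> F z \<subseteq> {c + v | c v. c \<in> F a \<and> v \<in> N}) \<Longrightarrow>
       \<exists>e\<in>F a. (\<Sum>k\<in>I. w k x *\<^sub>R c k) - e \<in> V"
proof -
  obtain y :: "nat \<Rightarrow> 'e" and \<gamma> :: "nat \<Rightarrow> real \<Rightarrow> real" and L :: "nat \<Rightarrow> 'z \<Rightarrow> real" and d :: "nat \<Rightarrow> real"
    where y: "\<And>k. k \<in> {1..n} \<Longrightarrow> \<exists>z\<in>K. y k \<in> T z" and L: "\<And>k. linear (L k)"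
    and \<gamma>: "\<And>k. k \<in> {1..n} \<Longrightarrow> continuous_on UNIV (\<gamma> k)" "\<And>k t. k \<in> {1..n} \<Longrightarrow> 0 \<le> \<gamma> k t"
    and \<gamma>1: "\<And>z. z \<in> K \<Longrightarrow> (\<Sum>k=1..n. \<gamma> k (L k z + d k)) = 1"
    and \<gamma>T: "\<And>z. z \<in> K \<Longrightarrow> (\<Sum>k=1..n. \<gamma> k (L k z + d k) *\<^sub>R y k) \<in> T z"
    by (rule WNQ_selection[OF K T]) (rule that)
  have "closedin Y (topspace Y - W)" "disjnt (topspace Y - W) D"
    using Y by (auto simp: disjnt_iff)
  from Urysohn_lemma[OF Y(1) this(1) Y(2) this(2) zero_le_one]
  obtain r :: "'z \<Rightarrow> real" where r: "continuous_map Y (top_of_set {0..1}) r"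
    and r0: "r ` (topspace Y - W) \<subseteq> {0}" and r1: "r ` D \<subseteq> {1}"
    by metis
  have rcont: "continuous_map Y euclideanreal r" and r01: "\<And>x. x \<in> topspace Y \<Longrightarrow> 0 \<le> r x \<and> r x \<le> 1"
    using r by (auto simp: continuous_map_in_subtopology)
  define q where "q z = (SOME e. e \<in> F z)" for z
  have q: "q z \<in> F z" if "z \<in> Z" for z
    using F(1)[OF that] by (simp add: q_def some_in_eq)
  define I where "I = {1..n} <+> Z"
  define c where "c = case_sum y q"
  define w where "w = case_sum (\<lambda>k x. r x * \<gamma> k (L k x + d k)) (\<lambda>z x. (1 - r x) * \<phi> z x)"
  define f where "f x = (\<Sum>k=1..n. \<gamma> k (L k x + d k) *\<^sub>R y k)" for x
  define g where "g x = (\<Sum>z\<in>Z. \<phi> z x *\<^sub>R q z)" for x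
  have blend: "(\<Sum>k\<in>I. w k x *\<^sub>R c k) = r x *\<^sub>R f x + (1 - r x) *\<^sub>R g x" for x
    unfolding I_def f_def g_def scaleR_sum_right
    using Z by (simp add: sum.Plus w_def c_def o_def)
  have inK: "x \<in> K" if "x \<in> topspace Y" "r x \<noteq> 0" for x
    using that r0 Y(5) by auto
  show thesis
  proof (rule that[of I c w])
    show "finite I" using Z by (simp add: I_def)
    show "c k \<in> (\<Union>x\<in>K. T x) \<union> (\<Union>z\<in>Z. F z)" if "k \<in> I" for k
      using that y q unfolding I_def c_def by fastforce
    show "0 \<le> w k x" if "k \<in> I" "x \<in> topspace Y" for k x
      using that \<gamma>(2) \<phi>(2) r01 by (auto simp: I_def w_def)
    show "(\<Sum>k\<in>I. w k x) = 1" if x: "x \<in> topspace Y" for x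
    proof -
      have "(\<Sum>k\<in>I. w k x) = r x * (\<Sum>k=1..n. \<gamma> k (L k x + d k)) + (1 - r x) * (\<Sum>z\<in>Z. \<phi> z x)"
        unfolding I_def sum_distrib_left using Z by (simp add: sum.Plus w_def o_def)
      also have "r x * (\<Sum>k=1..n. \<gamma> k (L k x + d k)) = r x"
        using \<gamma>1[OF inK[OF x]] by (cases "r x = 0") auto
      finally show ?thesis using \<phi>(3)[OF x] by simp
    qed
    show "continuous_map \<Lambda> euclideanreal (\<lambda>l. w k (m l))"
      if k: "k \<in> I" and m: "linearly_continuous_map \<Lambda> Y m" for k and \<Lambda> :: "'p topology" and m
    proof -
      have comp: "continuous_map \<Lambda> euclideanreal (\<lambda>l. h (m l))" if "continuous_map Y euclideanreal h" for h :: "'z \<Rightarrow> real"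
        using continuous_map_compose[OF _ that] m by (auto simp: linearly_continuous_map_def o_def)
      show ?thesis
      proof (cases k)
        case (Inl j)
        then have j: "j \<in> {1..n}" using k by (auto simp: I_def)
        have "continuous_map \<Lambda> euclideanreal (\<lambda>l. L j (m l) + d j)"
          using m L by (intro continuous_intros) (auto simp: linearly_continuous_map_def)
        moreover have "continuous_map euclideanreal euclideanreal (\<gamma> j)"
          using \<gamma>(1)[OF j] by simp
        ultimately have "continuous_map \<Lambda> euclideanreal (\<gamma> j \<circ> (\<lambda>l. L j (m l) + d j))"
          by (rule continuous_map_compose)
        then show ?thesis
          using Inl continuous_map_real_mult[OF comp[OF rcont]] by (auto simp: w_def o_def)
      next
        case (Inr z)
        then have "z \<in> Z" using k by (auto simp: I_def)
        then show ?thesis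
          using Inr by (auto simp: w_def intro!: continuous_intros comp rcont \<phi>(1))
      qed
    qed
    show "(\<Sum>k\<in>I. w k x *\<^sub>R c k) \<in> T x" if "x \<in> D" for x
    proof -
      have "r x = 1" "x \<in> K" using r1 that Y by auto
      then show ?thesis using \<gamma>T by (simp add: blend f_def)
    qed
    show "\<exists>e\<in>F a. (\<Sum>k\<in>I. w k x *\<^sub>R c k) - e \<in> V"
      if x: "x \<in> topspace Y" and a: "a \<in> topspace Y"
        and Fx: "F x \<subseteq> {c + v | c v. c \<in> F a \<and> v \<in> N}"
        and Fz: "\<And>z. z \<in> Z \<Longrightarrow> \<phi> z x \<noteq> 0 \<Longrightarrow> F z \<subseteq> {c + v | c v. c \<in> F a \<and> v \<in> N}" for x a
    proof -
      define S where "S = {c + v | c v. c \<in> F a \<and> v \<in> N}"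
      have "S = (\<Union>c\<in>F a. \<Union>v\<in>N. {c + v})" by (auto simp: S_def)
      then have S: "convex S" using convex_sums[OF F(2)[OF a] N(1)] by simp
      define Z' where "Z' = {z \<in> Z. \<phi> z x \<noteq> 0}"
      have "g x = (\<Sum>z\<in>Z'. \<phi> z x *\<^sub>R q z)"
        unfolding g_def Z'_def using Z by (intro sum.mono_neutral_right) auto
      also have "\<dots> \<in> S"
      proof (rule convex_sum[OF _ S])
        have "(\<Sum>z\<in>Z'. \<phi> z x) = (\<Sum>z\<in>Z. \<phi> z x)"
          unfolding Z'_def using Z by (intro sum.mono_neutral_left) auto
        then show "(\<Sum>z\<in>Z'. \<phi> z x) = 1" using \<phi>(3)[OF x] by simp
        show "q z \<in> S" if "z \<in> Z'" for z using Fz[of z] q[of z] that by (auto simp: Z'_def S_def)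
      qed (use Z \<phi>(2)[OF x] in \<open>auto simp: Z'_def\<close>)
      finally obtain c2 v2 where g: "g x = c2 + v2" "c2 \<in> F a" "v2 \<in> N" by (auto simp: S_def)
      \<comment> \<open>The factor \<open>r x\<close> is kept because \<open>f x\<close> is uncontrolled where \<open>r x = 0\<close>.\<close>
      have "\<exists>c1\<in>F a. \<exists>v1\<in>N. \<exists>u1\<in>N. r x *\<^sub>R f x = r x *\<^sub>R (c1 + v1 + u1)"
      proof (cases "r x = 0")
        case True
        then show ?thesis using g(2) N(2) by auto
      next
        case False
        then have "f x \<in> T x" using \<gamma>T[OF inK[OF x]] by (simp add: f_def)
        then obtain c0 u1 where "f x = c0 + u1" "c0 \<in> F x" "u1 \<in> N"
          using TF[OF inK[OF x False]] by blast
        moreover obtain c1 v1 where "c0 = c1 + v1" "c1 \<in> F a" "v1 \<in> N"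
          using Fx \<open>c0 \<in> F x\<close> by blast
        ultimately show ?thesis by auto
      qed
      then obtain c1 v1 u1 where f: "r x *\<^sub>R f x = r x *\<^sub>R (c1 + v1 + u1)" "c1 \<in> F a" "v1 \<in> N" "u1 \<in> N"
        by blast
      define e where "e = r x *\<^sub>R c1 + (1 - r x) *\<^sub>R c2"
      have cvx: "r x *\<^sub>R s + (1 - r x) *\<^sub>R t \<in> A" if "convex A" "s \<in> A" "t \<in> A" for A and s t :: 'e
        using r01[OF x] convexD[OF that, of "r x" "1 - r x"] by simp
      have "(\<Sum>k\<in>I. w k x *\<^sub>R c k) - e =
          (r x *\<^sub>R v1 + (1 - r x) *\<^sub>R v2) + (r x *\<^sub>R u1 + (1 - r x) *\<^sub>R 0)"
        unfolding blend f(1) g(1) e_def by (simp add: algebra_simps)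
      moreover have "r x *\<^sub>R v1 + (1 - r x) *\<^sub>R v2 \<in> N" "r x *\<^sub>R u1 + (1 - r x) *\<^sub>R 0 \<in> N"
        using f g N by (auto intro!: cvx simp del: scaleR_zero_right)
      moreover have "e \<in> F a" unfolding e_def using f g F(2)[OF a] by (intro cvx)
      ultimately show ?thesis using N(3) by metis
    qed
  qed
qed

lemma profile_top_compact_regular:
  assumes "\<And>i. locally_convex_space (E i)" "\<And>i. compactin (E i) (X i)"
  shows "topspace (profile_top E X) = profiles X" "compact_space (profile_top E X)"
    "regular_space (profile_top E X)" "normal_space (profile_top E X)"
proof -
  have "X i \<subseteq> topspace (E i)" for i using assms(2) compactin_subset_topspace by blast
  then show "topspace (profile_top E X) = profiles X"
    by (simp add: Int_absorb1)
  show c: "compact_space (profile_top E X)"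
    using assms(2) by (simp add: compact_space_product_topology compact_space_subtopology)
  show r: "regular_space (profile_top E X)"
    unfolding regular_space_product_topology
    using assms(1) tvs_regular_space regular_space_subtopology locally_convex_space_def by blast
  show "normal_space (profile_top E X)"
    using c r compact_Hausdorff_or_regular_imp_normal_space by blast
qed

lemma upper_semicontinuous_neighborhood:
  assumes E: "topological_vector_space E" and S: "S \<subseteq> topspace E"
    and F: "upper_semicontinuous Y (subtopology E S) F" "z \<in> topspace Y" "F z \<subseteq> S"
    and N: "neighborhood_of_zero E N"
  shows "\<exists>G. openin Y G \<and> z \<in> G \<and> (\<forall>y\<in>G. F y \<subseteq> {c + v | c v. c \<in> F z \<and> v \<in> N})"
proof -
  obtain U where U: "openin E U" "0 \<in> U" "U \<subseteq> N" using N by (auto simp: neighborhood_of_zero_def)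
  define O' where "O' = (\<Union>c\<in>F z. {y \<in> topspace E. y - c \<in> U})"
  have "openin E O'"
    unfolding O'_def using F(3) S U(1) by (auto intro!: openin_Union openin_tvs_translation[OF E])
  then have "openin (subtopology E S) (O' \<inter> S)" by (simp add: openin_subtopology_Int)
  moreover have "y \<in> O' \<inter> S" if "y \<in> F z" for y
    using that F(3) S U(2) unfolding O'_def by (auto intro!: bexI[of _ y])
  then have "F z \<subseteq> O' \<inter> S" by blast
  ultimately obtain G where G: "openin Y G" "z \<in> G" "\<forall>y\<in>G. F y \<subseteq> O' \<inter> S"
    using F(1,2) unfolding upper_semicontinuous_def by meson
  have "y \<in> {c + v | c v. c \<in> F z \<and> v \<in> N}" if y: "y \<in> O'" for y
  proof -
    obtain c where "c \<in> F z" "y - c \<in> N" using y U(3) by (auto simp: O'_def)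
    moreover have "y = c + (y - c)" by simp
    ultimately show ?thesis by blast
  qed
  then have "F y \<subseteq> {c + v | c v. c \<in> F z \<and> v \<in> N}" if "y \<in> G" for y
    using G(3) that by (meson IntD1 subsetD subsetI)
  with G(1,2) show ?thesis by blast
qed

text \<open>Finitely many requirements can be met at once. The set \<open>D i\<close> stands for the part of \<open>W i\<close> that has to be
  avoided; the values of \<open>F\<close> are approximated with error \<open>V i\<close> at a point \<open>z\<close> that is close to \<open>x\<close> in the sense
  of \<open>x \<in> U z\<close>, the same \<open>z\<close> for all agents. The profile \<open>x\<close> is a fixed point of the blended selections.
  If \<open>x\<close> were in \<open>D i\<close>, then \<open>x i\<close> would be a member of \<open>T i x\<close>, which the e-WNQS property forbids.\<close>

lemma approximate_equilibrium:
  fixes E :: "'i \<Rightarrow> 'e::real_vector topology" and F :: "'i \<Rightarrow> ('i \<Rightarrow> 'e) \<Rightarrow> 'e set"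
  assumes space: "\<And>i. locally_convex_space (E i)"
    and X: "\<And>i. X i \<noteq> {} \<and> compactin (E i) (X i) \<and> convex (X i)"
    and usc: "\<And>i. upper_semicontinuous (profile_top E X) (action_top E X i) (F i)"
    and F: "\<And>i x. x \<in> profiles X \<Longrightarrow> F i x \<noteq> {} \<and> convex (F i x) \<and> F i x \<subseteq> X i"
    and W: "\<And>i. openin (profile_top E X) (W i)" "\<And>i. W i \<subseteq> K i"
    and K: "\<And>i. simplex_on (n i) (K i)" "\<And>i. K i \<subseteq> profiles X"
    and WNQS: "\<And>i. e_WNQS E X i (K i) (F i)"
    and J: "finite J" and V: "\<And>i. i \<in> J \<Longrightarrow> neighborhood_of_zero (E i) (V i)"
    and D: "\<And>i. i \<in> J \<Longrightarrow> closedin (profile_top E X) (D i) \<and> D i \<subseteq> W i"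
    and U: "\<And>z. z \<in> profiles X \<Longrightarrow> openin (profile_top E X) (U z) \<and> z \<in> U z"
  obtains x z where "x \<in> profiles X" "z \<in> profiles X" "x \<in> U z" "\<And>i. i \<in> J \<Longrightarrow> x i \<in> X i \<and> x \<notin> D i"
    "\<And>i. i \<in> J \<Longrightarrow> \<exists>c\<in>F i z. x i - c \<in> V i"
proof -
  let ?Y = "profile_top E X"
  note Y = profile_top_compact_regular[of E X, OF space conjunct1[OF conjunct2[OF X]]]
  have tvs: "topological_vector_space (E i)" for i using space by (simp add: locally_convex_space_def)
  have XE: "X i \<subseteq> topspace (E i)" for i using X compactin_subset_topspace by blast
  have "\<forall>i\<in>J. \<exists>N. neighborhood_of_zero (E i) N \<and> convex N \<and> (\<forall>u\<in>N. \<forall>v\<in>N. u + v \<in> V i)"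
    using locally_convex_half_neighborhood[OF space V] by metis
  then obtain N where N: "\<And>i. i \<in> J \<Longrightarrow> neighborhood_of_zero (E i) (N i)" "\<And>i. i \<in> J \<Longrightarrow> convex (N i)"
    "\<And>i u v. i \<in> J \<Longrightarrow> u \<in> N i \<Longrightarrow> v \<in> N i \<Longrightarrow> u + v \<in> V i"
    by metis
  define near where "near i A B \<longleftrightarrow> A \<subseteq> {c + v | c v. c \<in> B \<and> v \<in> N i}" for i and A B :: "'e set"
  have "\<forall>i\<in>J. \<exists>T. correspondence (K i) (X i) T \<and> weakly_naturally_quasi_concave (K i) T \<and>
           (\<forall>x\<in>K i. x i \<notin> T x \<and> near i (T x) (F i x))"
    using WNQS N(1,2) unfolding e_WNQS_def near_def by blast
  then obtain T where TX: "\<And>i x. i \<in> J \<Longrightarrow> x \<in> K i \<Longrightarrow> T i x \<subseteq> X i"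
    and WNQ: "\<And>i. i \<in> J \<Longrightarrow> weakly_naturally_quasi_concave (K i) (T i)"
    and irrefl: "\<And>i x. i \<in> J \<Longrightarrow> x \<in> K i \<Longrightarrow> x i \<notin> T i x"
    and TF: "\<And>i x. i \<in> J \<Longrightarrow> x \<in> K i \<Longrightarrow> near i (T i x) (F i x)"
    unfolding correspondence_def by metis
  have "\<exists>G. openin ?Y G \<and> z \<in> G \<and> (\<forall>y\<in>G. near i (F i y) (F i z))" if "i \<in> J" "z \<in> profiles X" for i z
    unfolding near_def using that F[OF that(2)]
    by (intro upper_semicontinuous_neighborhood[OF tvs XE usc _ _ N(1)]) (auto simp only: Y(1))
  then obtain G where G: "\<And>i z. i \<in> J \<Longrightarrow> z \<in> profiles X \<Longrightarrow> openin ?Y (G i z) \<and> z \<in> G i z"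
    and GF: "\<And>i z y. i \<in> J \<Longrightarrow> z \<in> profiles X \<Longrightarrow> y \<in> G i z \<Longrightarrow> near i (F i y) (F i z)"
    by metis
  \<comment> \<open>Shrink \<open>U z\<close> so that, by upper semicontinuity, \<open>F i\<close> stays within error \<open>N i\<close> of \<open>F i z\<close> on it.\<close>
  define U' where "U' z = U z \<inter> (topspace ?Y \<inter> (\<Inter>i\<in>J. G i z))" for z
  have U': "openin ?Y (U' z) \<and> z \<in> U' z" if z: "z \<in> topspace ?Y" for z
  proof -
    have "openin ?Y (topspace ?Y \<inter> (\<Inter>i\<in>J. G i z))"
      using openin_INT[OF J, of ?Y "\<lambda>i. G i z"] G z unfolding Y(1) by (simp add: Int_commute)
    then show ?thesis using U G z unfolding U'_def Y(1) by blast
  qed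
  obtain Z \<phi> where Z: "finite Z" "Z \<subseteq> topspace ?Y"
    and \<phi>: "\<And>z. z \<in> Z \<Longrightarrow> continuous_map ?Y euclideanreal (\<phi> z)"
      "\<And>z x. x \<in> topspace ?Y \<Longrightarrow> 0 \<le> \<phi> z x"
      "\<And>x. x \<in> topspace ?Y \<Longrightarrow> (\<Sum>z\<in>Z. \<phi> z x) = 1"
    and star: "\<And>x. x \<in> topspace ?Y \<Longrightarrow>
      \<exists>a\<in>topspace ?Y. x \<in> U' a \<and> (\<forall>z\<in>Z. \<phi> z x \<noteq> 0 \<longrightarrow> z \<in> U' a)"
    by (rule star_refining_partition_of_unity[OF Y(2,3) U']) (assumption, rule that)
  define good where "good i I c w \<longleftrightarrow> finite I \<and> (\<forall>k\<in>I. c k \<in> X i) \<and>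
      (\<forall>k\<in>I. \<forall>x\<in>profiles X. 0 \<le> w k x) \<and> (\<forall>x\<in>profiles X. (\<Sum>k\<in>I. w k x) = 1) \<and>
      (\<forall>k\<in>I. \<forall>(\<Lambda> :: ('i \<times> (nat + ('i \<Rightarrow> 'e)) \<Rightarrow> real) topology) m. linearly_continuous_map \<Lambda> ?Y m \<longrightarrow>
         continuous_map \<Lambda> euclideanreal (\<lambda>l. w k (m l))) \<and>
      (\<forall>x\<in>D i. (\<Sum>k\<in>I. w k x *\<^sub>R c k) \<in> T i x) \<and>
      (\<forall>x\<in>profiles X. \<forall>a\<in>profiles X. near i (F i x) (F i a) \<longrightarrow>
         (\<forall>z\<in>Z. \<phi> z x \<noteq> 0 \<longrightarrow> near i (F i z) (F i a)) \<longrightarrow>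
         (\<exists>e\<in>F i a. (\<Sum>k\<in>I. w k x *\<^sub>R c k) - e \<in> V i))"
    for i and I :: "(nat + ('i \<Rightarrow> 'e)) set" and c :: "nat + ('i \<Rightarrow> 'e) \<Rightarrow> 'e"
      and w :: "nat + ('i \<Rightarrow> 'e) \<Rightarrow> ('i \<Rightarrow> 'e) \<Rightarrow> real"
  have "\<exists>I c w. good i I c w" if i: "i \<in> J" for i
  proof -
    have N0: "0 \<in> N i" using N(1)[OF i] by (auto simp: neighborhood_of_zero_def)
    show ?thesis
    proof (rule blended_selection[where 'p = "'i \<times> (nat + ('i \<Rightarrow> 'e)) \<Rightarrow> real", OF Y(4) _ W(1) _ W(2) K(1) WNQ[OF i] _ N(2)[OF i] N0 N(3)[OF i] Z(1),
          where D = "D i" and F = "F i" and \<phi> = \<phi>])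
      fix I :: "(nat + ('i \<Rightarrow> 'e)) set" and c w
      assume *: "finite I" "\<And>k. k \<in> I \<Longrightarrow> c k \<in> (\<Union>x\<in>K i. T i x) \<union> (\<Union>z\<in>Z. F i z)"
        "\<And>k x. k \<in> I \<Longrightarrow> x \<in> topspace ?Y \<Longrightarrow> 0 \<le> w k x"
        "\<And>x. x \<in> topspace ?Y \<Longrightarrow> (\<Sum>k\<in>I. w k x) = (1::real)"
        "\<And>k (\<Lambda> :: ('i \<times> (nat + ('i \<Rightarrow> 'e)) \<Rightarrow> real) topology) m. k \<in> I \<Longrightarrow> linearly_continuous_map \<Lambda> ?Y m \<Longrightarrow>
           continuous_map \<Lambda> euclideanreal (\<lambda>l. w k (m l))"
        "\<And>x. x \<in> D i \<Longrightarrow> (\<Sum>k\<in>I. w k x *\<^sub>R c k) \<in> T i x"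
        "\<And>x a. x \<in> topspace ?Y \<Longrightarrow> a \<in> topspace ?Y \<Longrightarrow> F i x \<subseteq> {c + v | c v. c \<in> F i a \<and> v \<in> N i} \<Longrightarrow>
           (\<And>z. z \<in> Z \<Longrightarrow> \<phi> z x \<noteq> 0 \<Longrightarrow> F i z \<subseteq> {c + v | c v. c \<in> F i a \<and> v \<in> N i}) \<Longrightarrow>
           \<exists>e\<in>F i a. (\<Sum>k\<in>I. w k x *\<^sub>R c k) - e \<in> V i"
      note * = *[unfolded Y(1)]
      have "good i I c w"
        unfolding good_def near_def
      proof (intro conjI ballI allI impI)
        show "c k \<in> X i" if "k \<in> I" for k
          using *(2)[OF that] TX[OF i] F Z(2) unfolding Y(1) by blast
        show "\<exists>e\<in>F i a. (\<Sum>k\<in>I. w k x *\<^sub>R c k) - e \<in> V i"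
          if "x \<in> profiles X" "a \<in> profiles X" "F i x \<subseteq> {c + v | c v. c \<in> F i a \<and> v \<in> N i}"
            "\<forall>z\<in>Z. \<phi> z x \<noteq> 0 \<longrightarrow> F i z \<subseteq> {c + v | c v. c \<in> F i a \<and> v \<in> N i}" for x a
          using that by (intro *(7)) blast+
      qed (fact *)+
      then show ?thesis by blast
    next
      show "T i x \<subseteq> {c + v |c v. c \<in> F i x \<and> v \<in> N i}" if "x \<in> K i" for x
        using TF[OF i that] by (simp add: near_def)
    qed (use D[OF i] F Z(2) \<phi> in \<open>auto simp: Y(1) subset_iff simp del: topspace_product_topology\<close>)
  qed
  then obtain I c w where good: "\<And>i. i \<in> J \<Longrightarrow> good i (I i) (c i) (w i)" by metis
  have "\<forall>i. \<exists>p. p \<in> X i" using X by blast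
  then obtain p where "\<And>i. p i \<in> X i" by metis
  then have p: "p \<in> profiles X" by auto
  obtain x where x: "x \<in> profiles X" and fixed: "\<And>i. i \<in> J \<Longrightarrow> x i = (\<Sum>k\<in>I i. w i k x *\<^sub>R c i k)"
  proof (rule polytopes_fixed_point[OF tvs _ XE p J, where M = I and c = c and w = w])
    show "finite (I i) \<and> I i \<noteq> {}" if "i \<in> J" for i
      \<comment> \<open>Weights that sum to 1 at \<open>p\<close> cannot have an empty index set.\<close>
      using good[OF that] p unfolding good_def by (metis sum.empty zero_neq_one)
  qed (use X good in \<open>auto simp: good_def\<close>)
  obtain a where a: "a \<in> profiles X" "x \<in> U' a" "\<And>z. z \<in> Z \<Longrightarrow> \<phi> z x \<noteq> 0 \<Longrightarrow> z \<in> U' a"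
    using star[of x] x unfolding Y(1) by blast
  have nearU: "near i (F i y) (F i a)" if "i \<in> J" "y \<in> U' a" for i y
    using GF[OF that(1) a(1)] that by (auto simp: U'_def)
  show thesis
  proof (rule that[OF x a(1)])
    show "x \<in> U a" using a(2) by (simp add: U'_def)
    show "x i \<in> X i \<and> x \<notin> D i" if i: "i \<in> J" for i
    proof
      show "x \<notin> D i"
      proof
        assume xD: "x \<in> D i"
        then have "x i \<in> T i x" using good[OF i] fixed[OF i] by (auto simp: good_def)
        moreover have "x \<in> K i" using xD D[OF i] W(2) by blast
        ultimately show False using irrefl[OF i] by blast
      qed
    qed (use x in auto)
    show "\<exists>c\<in>F i a. x i - c \<in> V i" if i: "i \<in> J" for i
    proof -
      have "\<exists>e\<in>F i a. (\<Sum>k\<in>I i. w i k x *\<^sub>R c i k) - e \<in> V i"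
        using good[OF i] x a nearU[OF i] unfolding good_def by blast
      then show ?thesis unfolding fixed[OF i, symmetric] .
    qed
  qed
qed


section \<open>Existence of an equilibrium\<close>

lemma regular_space_shrink:
  assumes "regular_space Y" "openin Y G" "a \<in> G"
  shows "\<exists>U C. openin Y U \<and> closedin Y C \<and> a \<in> U \<and> U \<subseteq> C \<and> C \<subseteq> G"
  using assms unfolding neighbourhood_base_of_closedin[symmetric] neighbourhood_base_of by blast

text \<open>If \<open>(a, f a)\<close> is off the closure of the graph of \<open>B\<close>, this stays true with a uniform margin \<open>N\<close> when the
  two occurrences of \<open>a\<close> are moved independently within a neighbourhood. The independence is essential,
  since an approximate equilibrium compares \<open>x\<close> with a value of the correspondence at another point.
  Taking the closure of the values of \<open>B\<close> does no harm, because the separating neighbourhood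
  of \<open>f a\<close> is open.\<close>

lemma separation_off_graph_closure:
  assumes E: "topological_vector_space E" and S: "S \<subseteq> topspace E"
    and f: "continuous_map Y (subtopology E S) f" and a: "a \<in> topspace Y"
    and off: "f a \<notin> graph_closure_corr Y (subtopology E S) B a"
  shows "\<exists>G N. openin Y G \<and> a \<in> G \<and> neighborhood_of_zero E N \<and>
     (\<forall>y\<in>G. \<forall>z\<in>G. \<forall>c\<in>cl_corr (subtopology E S) B z. f y - c \<notin> N)"
proof -
  let ?S = "subtopology E S"
  define Gr where "Gr = {(u, v). u \<in> topspace Y \<and> v \<in> topspace ?S \<and> v \<in> B u}"
  have fa: "f a \<in> topspace ?S" using f a by (auto simp: continuous_map_def)
  then have "(a, f a) \<notin> prod_topology Y ?S closure_of Gr"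
    using off by (auto simp: graph_closure_corr_def Gr_def)
  then obtain H where H: "openin (prod_topology Y ?S) H" "(a, f a) \<in> H" "Gr \<inter> H = {}"
    using a fa unfolding in_closure_of by (auto simp: disjoint_iff)
  obtain G1 M where G1: "openin Y G1" "openin ?S M" "a \<in> G1" "f a \<in> M" "G1 \<times> M \<subseteq> H"
    using H(1,2) by (rule openin_prod_topologyE)
  obtain M' where M': "openin E M'" "M = M' \<inter> S" using G1(2) by (auto simp: openin_subtopology)
  have "f a \<in> M'" using G1(4) M'(2) by simp
  then obtain A N where A: "openin E A" "0 \<in> A" and N: "openin E N" "0 \<in> N"
    and AN: "\<And>u v. u \<in> A \<Longrightarrow> v \<in> N \<Longrightarrow> f a + u - v \<in> M'"
    using tvs_diff_neighborhoods[OF E M'(1), of "f a"] by metis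
  have fE: "continuous_map Y E f" using f by (simp add: continuous_map_in_subtopology)
  define G where "G = G1 \<inter> {y \<in> topspace Y. f y - f a \<in> A}"
  have "continuous_map Y E (\<lambda>y. f y - f a)"
    using fa by (intro continuous_map_tvs_diff[OF E fE]) simp
  then have "openin Y G"
    unfolding G_def using G1(1) A(1) by (intro openin_Int openin_continuous_map_preimage)
  moreover have "a \<in> G" using a G1(3) A(2) by (simp add: G_def)
  moreover have "neighborhood_of_zero E N"
    using N openin_subset by (auto simp: neighborhood_of_zero_def)
  moreover have "f y - c \<notin> N" if y: "y \<in> G" and z: "z \<in> G" and c: "c \<in> cl_corr ?S B z" for y z c
  proof
    assume "f y - c \<in> N"
    then have "c \<in> M'" using AN[of "f y - f a" "f y - c"] y by (simp add: G_def)
    moreover have c': "c \<in> ?S closure_of B z" using c by (simp add: cl_corr_def)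
    moreover have "c \<in> S" using c' closure_of_subset_topspace[of ?S "B z"] by auto
    ultimately have "c \<in> M" using M'(2) by blast
    then obtain b where b: "b \<in> B z" "b \<in> M" using c' G1(2) unfolding in_closure_of by blast
    then have "(z, b) \<in> Gr \<inter> H"
      using z G1 openin_subset[OF G1(1)] openin_subset[OF G1(2)] by (auto simp: Gr_def G_def)
    then show False using H(3) by blast
  qed
  ultimately show ?thesis by blast
qed

theorem theorem15:
  fixes E :: "'i \<Rightarrow> 'e::real_vector topology"
    and X :: "'i \<Rightarrow> 'e set"
    and A P B :: "'i \<Rightarrow> ('i \<Rightarrow> 'e) \<Rightarrow> 'e set"
    and K :: "'i \<Rightarrow> ('i \<Rightarrow> 'e) set"
    and n :: "'i \<Rightarrow> nat"
  assumes economy: "abstract_economy X A P B"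
    and space: "\<And>i. locally_convex_space (E i)"
    and actions: "\<And>i. X i \<noteq> {} \<and> compactin (E i) (X i) \<and> convex (X i)"
    and clB_usc: "\<And>i. upper_semicontinuous (profile_top E X) (action_top E X i)
                          (cl_corr (action_top E X i) (B i))"
    and clB_values: "\<And>i x. x \<in> profiles X \<Longrightarrow>
                       cl_corr (action_top E X i) (B i) x \<noteq> {} \<and>
                       convex (cl_corr (action_top E X i) (B i) x)"
    and W_open: "\<And>i. openin (profile_top E X) {x \<in> profiles X. A i x \<inter> P i x \<noteq> {}}"
    and K_simplex: "\<And>i. n i > 0 \<and> simplex_on (n i) (K i) \<and> K i \<subseteq> profiles X"
    and W_sub: "\<And>i. {x \<in> profiles X. A i x \<inter> P i x \<noteq> {}}
                       \<subseteq> profile_top E X interior_of K i"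
    and WNQS: "\<And>i. e_WNQS E X i (K i) (cl_corr (action_top E X i) (B i))"
  shows "\<exists>x. equilibrium_point E X A P B x"
proof (rule ccontr)
  assume no_equilibrium: "\<nexists>x. equilibrium_point E X A P B x"
  let ?Y = "profile_top E X"
  define F where "F i = cl_corr (action_top E X i) (B i)" for i
  define W where "W i = {x \<in> profiles X. A i x \<inter> P i x \<noteq> {}}" for i
  note Y = profile_top_compact_regular[of E X, OF space conjunct1[OF conjunct2[OF actions]]]
  have tvs: "topological_vector_space (E i)" for i using space by (simp add: locally_convex_space_def)
  have XE: "X i \<subseteq> topspace (E i)" for i using actions compactin_subset_topspace by blast
  have FX: "F i x \<noteq> {} \<and> convex (F i x) \<and> F i x \<subseteq> X i" if "x \<in> profiles X" for i x
    using clB_values[OF that, of i] closure_of_subset_topspace[of "action_top E X i" "B i x"]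
    by (auto simp: F_def cl_corr_def)
  have WK: "W i \<subseteq> K i" for i
    using W_sub[of i] interior_of_subset[of ?Y "K i"] by (auto simp: W_def)
  \<comment> \<open>The two ways to fail to be an equilibrium, in the form that holds on a whole neighbourhood.\<close>
  define refutes where "refutes i G N \<longleftrightarrow> neighborhood_of_zero (E i) N \<and>
      (G \<subseteq> W i \<or> (\<forall>y\<in>G. \<forall>z\<in>G. \<forall>c\<in>F i z. y i - c \<notin> N))" for i G N
  define excludes where "excludes a i N G O' C \<longleftrightarrow>
      refutes i G N \<and> openin ?Y O' \<and> a \<in> O' \<and> O' \<subseteq> C \<and> closedin ?Y C \<and> C \<subseteq> G"
    for a i N G O' C
  have "\<exists>i N G O' C. excludes a i N G O' C" if a: "a \<in> topspace ?Y" for a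
  proof -
    have aX: "a \<in> profiles X" using a unfolding Y(1) .
    have "\<exists>i N G. refutes i G N \<and> openin ?Y G \<and> a \<in> G"
    proof -
      obtain i where "a i \<notin> graph_closure_corr ?Y (action_top E X i) (B i) a \<or> a \<in> W i"
        using no_equilibrium aX unfolding equilibrium_point_def W_def by blast
      then show ?thesis
      proof
        assume off: "a i \<notin> graph_closure_corr ?Y (action_top E X i) (B i) a"
        have "continuous_map ?Y (action_top E X i) (\<lambda>x. x i)"
          by (rule continuous_map_product_projection) simp
        from separation_off_graph_closure[OF tvs XE this a off]
        show ?thesis unfolding refutes_def F_def by blast
      next
        assume "a \<in> W i"
        moreover have "neighborhood_of_zero (E i) (topspace (E i))"
          using neighborhood_of_zero_Inter[OF tvs, of "{}"] by simp
        ultimately show ?thesis using W_open unfolding refutes_def W_def by blast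
      qed
    qed
    then obtain i N G where G: "refutes i G N" "openin ?Y G" "a \<in> G" by (elim exE conjE)
    obtain O' C where "openin ?Y O'" "closedin ?Y C" "a \<in> O'" "O' \<subseteq> C" "C \<subseteq> G"
      using regular_space_shrink[OF Y(3) G(2,3)] by (elim exE conjE)
    with G(1) have "excludes a i N G O' C"
      unfolding excludes_def by (intro conjI)
    then show ?thesis by (intro exI)
  qed
  then obtain \<iota> N G O' C where "\<And>a. a \<in> topspace ?Y \<Longrightarrow> excludes a (\<iota> a) (N a) (G a) (O' a) (C a)"
    by metis
  then have ref: "refutes (\<iota> a) (G a) (N a)" and O': "openin ?Y (O' a) \<and> a \<in> O' a"
      and C: "O' a \<subseteq> C a \<and> closedin ?Y (C a) \<and> C a \<subseteq> G a" if "a \<in> topspace ?Y" for a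
    using that unfolding excludes_def by blast+
  obtain Q where Q: "finite Q" "Q \<subseteq> topspace ?Y" and cover: "topspace ?Y \<subseteq> (\<Union>a\<in>Q. O' a)"
    by (rule compact_space_neighborhood_subcover[OF Y(2) O']) (assumption, rule that)
  \<comment> \<open>Now ask for an approximate equilibrium that is finer than all the finitely many refutations.\<close>
  define V where "V i = topspace (E i) \<inter> (\<Inter>a\<in>{a \<in> Q. \<iota> a = i}. N a)" for i
  define D where "D i = (\<Union>a\<in>{a \<in> Q. \<iota> a = i \<and> G a \<subseteq> W i}. C a)" for i
  \<comment> \<open>This choice makes \<open>x \<in> U z\<close> and \<open>x \<in> C a\<close> imply \<open>z \<in> C a\<close>.\<close>
  define U where "U z = (\<Inter>a\<in>{a \<in> Q. z \<notin> C a}. topspace ?Y - C a) \<inter> topspace ?Y" for z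
  have V: "neighborhood_of_zero (E i) (V i)" for i
    unfolding V_def using Q ref
    by (intro neighborhood_of_zero_Inter[OF tvs]) (auto simp: refutes_def)
  have D: "closedin ?Y (D i) \<and> D i \<subseteq> W i" for i
  proof
    show "closedin ?Y (D i)"
      unfolding D_def using Q C by (auto intro!: closedin_Union)
    show "D i \<subseteq> W i"
      unfolding D_def
    proof (rule UN_least)
      fix a assume "a \<in> {a \<in> Q. \<iota> a = i \<and> G a \<subseteq> W i}"
      then have "a \<in> topspace ?Y" "G a \<subseteq> W i" using Q(2) by blast+
      then show "C a \<subseteq> W i" using C by blast
    qed
  qed
  have U: "openin ?Y (U z) \<and> z \<in> U z" if "z \<in> profiles X" for z
  proof
    show "openin ?Y (U z)"
      unfolding U_def
    proof (rule openin_INT)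
      fix a assume "a \<in> {a \<in> Q. z \<notin> C a}"
      then have "a \<in> topspace ?Y" using Q(2) by blast
      then show "openin ?Y (topspace ?Y - C a)" using C by blast
    qed (use Q in simp)
    show "z \<in> U z" using that unfolding U_def Y(1) by blast
  qed
  obtain x z where x: "x \<in> profiles X" and z: "z \<in> profiles X" "x \<in> U z"
    and D': "\<And>i. i \<in> \<iota> ` Q \<Longrightarrow> x i \<in> X i \<and> x \<notin> D i"
    and V': "\<And>i. i \<in> \<iota> ` Q \<Longrightarrow> \<exists>c\<in>F i z. x i - c \<in> V i"
    by (rule approximate_equilibrium[where F = F and W = W and K = K and J = "\<iota> ` Q" and D = D
          and V = V and U = U and n = n and E = E and X = X])
      (assumption | rule space actions FX WK WNQS[folded F_def] clB_usc[folded F_def] V D U that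
        W_open[folded W_def] conjunct1[OF conjunct2[OF K_simplex]] conjunct2[OF conjunct2[OF K_simplex]]
        finite_imageI Q)+
  obtain a where a: "a \<in> Q" "x \<in> O' a" using cover x unfolding Y(1) by blast
  have aY: "a \<in> topspace ?Y" using a Q by blast
  have xC: "x \<in> C a" using a C[OF aY] by blast
  have "\<not> G a \<subseteq> W (\<iota> a)" using D'[of "\<iota> a"] a xC by (auto simp: D_def)
  moreover have "z \<in> C a" using z(2) a xC unfolding U_def by blast
  moreover obtain c where "c \<in> F (\<iota> a) z" "x (\<iota> a) - c \<in> N a"
    using V'[of "\<iota> a"] a by (auto simp: V_def)
  ultimately show False
    using ref[OF aY] C[OF aY] xC unfolding refutes_def by blast
qed

end
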